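(* Let $\rho(s)$, $s\in[0,1]$, be the solution of the differential equation \[\frac{d\rho}{ds} = \lambda(s)\,\mathcal{L}_s(\rho),\] where $\lambda:[0,1]\to(0,\infty)$ and, for each $s$, $\mathcal{L}_s$ is a linear operator on (trace-class) operators. Suppose (a) $\operatorname{Tr}\big(P(0)\rho(0)\big)=1$; (b) $\operatorname{Tr}(P(s)Y)=0$ for all $Y$ in the image of $\mathcal{L}_s$, for all $s\in[0,1]$; (c) there exists a differentiable family of bounded operators $X(s)$ such that $P'(s)=\mathcal{L}_s^*\big(X(s)\big)$ for all $s\in[0,1]$; (d) $1/\lambda$ is absolutely continuous. Then \[1-\operatorname{Tr}\big(P(1)\rho(1)\big)\le \frac{\|X\|}{\lambda}\Big|_{s=0}+\frac{\|X\|}{\lambda}\Big|_{s=1}+\int_0^1\Big(\frac{\|X'\|}{\lambda}+\Big|\Big(\frac1\lambda\Big)'\Big|\,\|X\|\Big)\,ds.\]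
   Context: $\mathcal{H}$ is a (possibly infinite-dimensional) Hilbert space. $P(s)$, $s\in[0,1]$, is a differentiable family of orthogonal projectors on $\mathcal{H}$ (in the paper, the spectral projector of a path of bounded Hamiltonians $H(s)$ onto the part of its spectrum in a given spectral region); primes denote derivatives with respect to $s$. $\rho(s)$ is a family of density matrices (positive trace-class operators of trace one). $\mathcal{L}_s^*$ denotes the adjoint of $\mathcal{L}_s$ with respect to the trace pairing, i.e. $\operatorname{Tr}\big(\mathcal{L}_s^*(X)\sigma\big)=\operatorname{Tr}\big(X\mathcal{L}_s(\sigma)\big)$ for all bounded $X$ and trace-class $\sigma$. $\|\cdot\|$ is the operator norm. *)

theory Defs
  imports "HOL-Analysis.Analysis"
begin

text \<open>
  A complex Hilbert space is encoded as a real Hilbert space (the type 'h, with the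
  real inner product Re of the complex one) together with a complex structure J
  (multiplication by the imaginary unit), which is an orthogonal map with J o J = -1.
  Complex-linear bounded operators are the bounded real-linear ones commuting with J.
\<close>

definition complex_structure :: "('h::real_inner \<Rightarrow>\<^sub>L 'h) \<Rightarrow> bool" where
  "complex_structure J \<longleftrightarrow>
     (\<forall>x. blinfun_apply J (blinfun_apply J x) = - x) \<and>
     (\<forall>x y. inner (blinfun_apply J x) (blinfun_apply J y) = inner x y)"

definition clinear_op :: "('h::real_inner \<Rightarrow>\<^sub>L 'h) \<Rightarrow> ('h \<Rightarrow>\<^sub>L 'h) \<Rightarrow> bool" where
  "clinear_op J A \<longleftrightarrow> A o\<^sub>L J = J o\<^sub>L A"

definition cscale_op :: "('h::real_inner \<Rightarrow>\<^sub>L 'h) \<Rightarrow> complex \<Rightarrow> ('h \<Rightarrow>\<^sub>L 'h) \<Rightarrow> ('h \<Rightarrow>\<^sub>L 'h)" where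
  "cscale_op J c A = Re c *\<^sub>R A + Im c *\<^sub>R (J o\<^sub>L A)"

definition self_adjoint_op :: "('h::real_inner \<Rightarrow>\<^sub>L 'h) \<Rightarrow> bool" where
  "self_adjoint_op A \<longleftrightarrow> (\<forall>x y. inner x (blinfun_apply A y) = inner (blinfun_apply A x) y)"

definition orthonormal_basis :: "'h::real_inner set \<Rightarrow> bool" where
  "orthonormal_basis B \<longleftrightarrow> (\<forall>e\<in>B. norm e = 1) \<and>
     (\<forall>e\<in>B. \<forall>f\<in>B. e \<noteq> f \<longrightarrow> inner e f = 0) \<and> closure (span B) = UNIV"

definition nuclear_rep :: "('h::real_inner \<Rightarrow>\<^sub>L 'h) \<Rightarrow> (nat \<Rightarrow> 'h) \<Rightarrow> (nat \<Rightarrow> 'h) \<Rightarrow> bool" where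
  "nuclear_rep T a b \<longleftrightarrow> summable (\<lambda>n. norm (a n) * norm (b n)) \<and>
     (\<forall>x. blinfun_apply T x = (\<Sum>n. inner (b n) x *\<^sub>R a n))"

definition trace_class :: "('h::real_inner \<Rightarrow>\<^sub>L 'h) \<Rightarrow> bool" where
  "trace_class T \<longleftrightarrow> (\<exists>a b. nuclear_rep T a b)"

definition trace_norm :: "('h::real_inner \<Rightarrow>\<^sub>L 'h) \<Rightarrow> real" where
  "trace_norm T = Inf {\<Sum>n. norm (a n) * norm (b n) | a b. nuclear_rep T a b}"

definition rtrace :: "('h::real_inner \<Rightarrow>\<^sub>L 'h) \<Rightarrow> real" where
  "rtrace T = infsum (\<lambda>e. inner e (blinfun_apply T e)) (SOME B. orthonormal_basis B)"

definition ctrace :: "('h::real_inner \<Rightarrow>\<^sub>L 'h) \<Rightarrow> ('h \<Rightarrow>\<^sub>L 'h) \<Rightarrow> complex" where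
  "ctrace J T = Complex (rtrace T / 2) (- rtrace (J o\<^sub>L T) / 2)"

definition density_op :: "('h::real_inner \<Rightarrow>\<^sub>L 'h) \<Rightarrow> ('h \<Rightarrow>\<^sub>L 'h) \<Rightarrow> bool" where
  "density_op J \<rho> \<longleftrightarrow> clinear_op J \<rho> \<and> trace_class \<rho> \<and> self_adjoint_op \<rho> \<and>
     (\<forall>x. inner x (blinfun_apply \<rho> x) \<ge> 0) \<and> ctrace J \<rho> = 1"

definition orth_projector :: "('h::real_inner \<Rightarrow>\<^sub>L 'h) \<Rightarrow> ('h \<Rightarrow>\<^sub>L 'h) \<Rightarrow> bool" where
  "orth_projector J P \<longleftrightarrow> clinear_op J P \<and> P o\<^sub>L P = P \<and> self_adjoint_op P"

definition has_trace_norm_derivative ::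
  "(real \<Rightarrow> ('h::real_inner \<Rightarrow>\<^sub>L 'h)) \<Rightarrow> ('h \<Rightarrow>\<^sub>L 'h) \<Rightarrow> real \<Rightarrow> real set \<Rightarrow> bool" where
  "has_trace_norm_derivative f D s S \<longleftrightarrow>
     ((\<lambda>t. trace_norm ((1 / (t - s)) *\<^sub>R (f t - f s) - D)) \<longlongrightarrow> 0) (at s within S)"

definition abs_continuous_on :: "real set \<Rightarrow> (real \<Rightarrow> real) \<Rightarrow> bool" where
  "abs_continuous_on S f \<longleftrightarrow> (\<forall>\<epsilon>>0. \<exists>\<delta>>0. \<forall>(n::nat) (a::nat\<Rightarrow>real) b.
     (\<forall>i<n. a i \<le> b i \<and> {a i..b i} \<subseteq> S) \<and>
     (\<forall>i<n. \<forall>j<n. i \<noteq> j \<longrightarrow> {a i<..<b i} \<inter> {a j<..<b j} = {}) \<and>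
     (\<Sum>i<n. b i - a i) < \<delta> \<longrightarrow> (\<Sum>i<n. \<bar>f (b i) - f (a i)\<bar>) < \<epsilon>)"

end

theory Submission
  imports Defs
begin

text \<open>
  Put \<open>F(s) = Tr(P \<rho>)\<close> and \<open>\<tau>(s) = Tr(X \<rho>)\<close>. By (b) the term \<open>Tr(P \<rho>')\<close> vanishes, and by (c)
  \<open>F' = Tr(P' \<rho>) = Tr(X L(\<rho>)) = (1/\<lambda>) Tr(X \<rho>') = (1/\<lambda>) (\<tau>' - Tr(X' \<rho>))\<close>. Integrating by parts moves
  the derivative from \<open>\<tau>\<close> to \<open>1/\<lambda>\<close>, and \<open>|Tr(A \<rho>)| \<le> \<parallel>A\<parallel>\<close> for a density operator \<open>\<rho>\<close> bounds every term.

  The derivatives are not assumed integrable, so the integration by parts is carried out for the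
  Henstock--Kurzweil integral: where \<open>1/\<lambda>\<close> is not differentiable, a null set, the gauge is chosen
  inside a small open set and absolute continuity makes the contribution small. That this set is null
  follows from the Vitali covering theorem, without passing through functions of bounded variation.
  The trace bound is reduced to finite positive semidefinite matrices, for which a Cholesky
  decomposition avoids spectral theory and operator square roots.
\<close>

section \<open>Orthonormal bases\<close>

text \<open>The complex structure enters the estimate only through the real part of
  \<open>ctrace\<close>, which is half the trace of the same operator on the underlying real space.
  The analysis therefore uses real inner products with factors 2 and 1/2, and \<open>J\<close>
  returns only where (b) and (c) are applied. All traces are taken in the single basis picked by
  \<open>SOME\<close>: additivity, the trace-norm bound and the bound by the operator norm can each
  be proved in that basis, so neither basis independence nor cyclicity of the trace has to be
  established. The delicate bound is |Tr(X \<rho>)| \<le> \<parallel>X\<parallel>. Since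
  \<open>trace_norm\<close> is an infimum over nuclear representations, the general inequality |Tr(A
  T)| \<le> \<parallel>A\<parallel> \<open>trace_norm T\<close> would help only if that infimum were
  known to equal the trace for positive operators, which is a spectral fact. Compressing \<rho> to
  the span of finitely many basis vectors replaces it by a matrix statement and an error that
  vanishes in the limit.\<close>

definition orthonormal_set :: "'h::real_inner set \<Rightarrow> bool" where
  "orthonormal_set B \<longleftrightarrow> (\<forall>e\<in>B. norm e = 1) \<and> (\<forall>e\<in>B. \<forall>f\<in>B. e \<noteq> f \<longrightarrow> inner e f = 0)"

definition proj_on :: "'h::real_inner set \<Rightarrow> 'h \<Rightarrow> 'h" where
  "proj_on F x = (\<Sum>e\<in>F. inner e x *\<^sub>R e)"

lemma orthonormal_set_subset: "orthonormal_set B \<Longrightarrow> F \<subseteq> B \<Longrightarrow> orthonormal_set F"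
  by (auto simp: orthonormal_set_def subset_iff)

lemma inner_orthonormal_sum:
  assumes "orthonormal_set F" "finite F" "e \<in> F"
  shows "inner e (\<Sum>f\<in>F. c f *\<^sub>R f) = c e"
proof -
  have "inner e (\<Sum>f\<in>F. c f *\<^sub>R f) = (\<Sum>f\<in>F. c f * inner e f)"
    by (simp add: inner_sum_right)
  also have "\<dots> = (\<Sum>f\<in>F. if f = e then c e else 0)"
    using assms unfolding orthonormal_set_def
    by (intro sum.cong) (auto simp: norm_eq_1)
  finally show ?thesis using assms by simp
qed

lemma norm_orthonormal_sum:
  assumes "orthonormal_set F" "finite F"
  shows "(norm (\<Sum>f\<in>F. c f *\<^sub>R f))\<^sup>2 = (\<Sum>f\<in>F. (c f)\<^sup>2)"
proof -
  have "(norm (\<Sum>f\<in>F. c f *\<^sub>R f))\<^sup>2 = (\<Sum>e\<in>F. c e * inner e (\<Sum>f\<in>F. c f *\<^sub>R f))"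
    by (simp add: power2_norm_eq_inner inner_sum_left)
  also have "\<dots> = (\<Sum>f\<in>F. (c f)\<^sup>2)"
    using assms by (intro sum.cong) (auto simp: inner_orthonormal_sum power2_eq_square)
  finally show ?thesis .
qed

lemma inner_proj_residual:
  assumes "orthonormal_set F" "finite F" "y \<in> span F"
  shows "inner y (x - proj_on F x) = 0"
  using assms(3)
proof (induction rule: span_induct_alt)
  case base
  then show ?case by simp
next
  case (step c e y)
  then show ?case
    using inner_orthonormal_sum[OF assms(1,2) step(1), of "\<lambda>e. inner e x"]
    by (simp add: inner_add_left inner_diff_right proj_on_def)
qed

lemma proj_on_in_span: "proj_on F x \<in> span F"
  unfolding proj_on_def by (intro span_sum span_scale span_base)

lemma norm_Pythagoras:
  fixes x y :: "'a::real_inner"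
  assumes "inner x y = 0"
  shows "(norm (x + y))\<^sup>2 = (norm x)\<^sup>2 + (norm y)\<^sup>2"
  using assms by (simp add: power2_norm_eq_inner inner_add_left inner_add_right inner_commute)

lemma proj_on_best_approx:
  assumes "orthonormal_set F" "finite F" "y \<in> span F"
  shows "norm (x - proj_on F x) \<le> norm (x - y)"
proof -
  have "proj_on F x - y \<in> span F"
    using assms proj_on_in_span span_diff by blast
  then have "(norm ((proj_on F x - y) + (x - proj_on F x)))\<^sup>2
      = (norm (proj_on F x - y))\<^sup>2 + (norm (x - proj_on F x))\<^sup>2"
    by (intro norm_Pythagoras inner_proj_residual assms)
  then have "(norm (x - proj_on F x))\<^sup>2 \<le> (norm (x - y))\<^sup>2" by simp
  then show ?thesis by (rule power2_le_imp_le) simp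
qed

lemma norm_proj_on_le:
  assumes "orthonormal_set F" "finite F"
  shows "norm (proj_on F x) \<le> norm x"
proof -
  have "(norm (proj_on F x + (x - proj_on F x)))\<^sup>2
      = (norm (proj_on F x))\<^sup>2 + (norm (x - proj_on F x))\<^sup>2"
    by (intro norm_Pythagoras inner_proj_residual assms proj_on_in_span)
  then have "(norm (proj_on F x))\<^sup>2 \<le> (norm x)\<^sup>2" by simp
  then show ?thesis by (rule power2_le_imp_le) simp
qed

lemma Bessel_inequality:
  assumes "orthonormal_set F" "finite F"
  shows "(\<Sum>e\<in>F. (inner e x)\<^sup>2) \<le> (norm x)\<^sup>2"
  using power_mono[OF norm_proj_on_le[OF assms, of x] norm_ge_zero, of 2]
    norm_orthonormal_sum[OF assms, of "\<lambda>e. inner e x"]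
  unfolding proj_on_def by simp

lemma Bessel_Cauchy_Schwarz:
  assumes "orthonormal_set F" "finite F"
  shows "(\<Sum>e\<in>F. \<bar>inner e x * inner e y\<bar>) \<le> norm x * norm y"
proof -
  have "(\<Sum>e\<in>F. \<bar>inner e x * inner e y\<bar>) \<le> L2_set (\<lambda>e. inner e x) F * L2_set (\<lambda>e. inner e y) F"
    using L2_set_mult_ineq[of "\<lambda>e. inner e x" "\<lambda>e. inner e y" F] by (simp add: abs_mult)
  also have "\<dots> \<le> norm x * norm y"
    unfolding L2_set_def
    by (intro mult_mono real_sqrt_ge_zero sum_nonneg real_le_lsqrt norm_ge_zero Bessel_inequality assms) auto
  finally show ?thesis .
qed

text \<open>A minimising sequence in \<open>V\<close> for the distance from \<open>x\<close> is
  Cauchy by the parallelogram identity. Its limit is known only as a limit of points of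
  \<open>V\<close>, but the residual remains minimal under translation by \<open>V\<close>, and this
  is what the variational argument for orthogonality uses.\<close>

lemma orthogonal_to_closed_subspace_exists:
  fixes V :: "'h::{real_inner,complete_space} set"
  assumes "subspace V" and x: "x \<notin> closure V"
  shows "\<exists>z. z \<noteq> 0 \<and> (\<forall>v\<in>V. inner v z = 0)"
proof -
  define d where "d = infdist x V"
  have V0: "V \<noteq> {}" using assms subspace_0 by blast
  have d0: "d > 0"
    using x V0 in_closure_iff_infdist_zero[of V x] infdist_nonneg[of x V] unfolding d_def by force
  have dle: "d \<le> norm (x - v)" if "v \<in> V" for v
    using infdist_le[OF that, of x] unfolding d_def by (simp add: dist_norm)
  have "\<exists>v\<in>V. norm (x - v) < d + 1 / real (Suc n)" for n
  proof (rule ccontr)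
    assume "\<not> ?thesis"
    then have "d + 1 / real (Suc n) \<le> dist x v" if "v \<in> V" for v
      using that by (force simp: dist_norm)
    then have "d + 1 / real (Suc n) \<le> infdist x V"
      using V0 unfolding infdist_def by (auto intro!: cINF_greatest)
    moreover have "1 / real (Suc n) > 0" by simp
    ultimately show False unfolding d_def by linarith
  qed
  then obtain y where yV: "\<And>n. y n \<in> V" and y: "\<And>n. norm (x - y n) < d + 1 / real (Suc n)"
    by metis
  \<comment> \<open>Parallelogram identity: the midpoint lies in \<open>V\<close>, so its distance
    from \<open>x\<close> is at least \<open>d\<close>.\<close>
  have par: "(norm (y m - y n))\<^sup>2 \<le> 2 * (norm (x - y m))\<^sup>2 + 2 * (norm (x - y n))\<^sup>2 - 4 * d\<^sup>2" for m n
  proof -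
    have "(1/2) *\<^sub>R (y m + y n) \<in> V"
      using yV assms(1) by (intro subspace_scale subspace_add)
    then have "d \<le> norm (x - (1/2) *\<^sub>R (y m + y n))" by (rule dle)
    moreover have "(norm (y m - y n))\<^sup>2
       = 2 * (norm (x - y m))\<^sup>2 + 2 * (norm (x - y n))\<^sup>2 - 4 * (norm (x - (1/2) *\<^sub>R (y m + y n)))\<^sup>2"
      by (simp add: power2_norm_eq_inner inner_diff_left inner_diff_right inner_add_left
          inner_add_right inner_commute algebra_simps)
    moreover have "d\<^sup>2 \<le> (norm (x - (1/2) *\<^sub>R (y m + y n)))\<^sup>2"
      using calculation(1) d0 by (intro power_mono) auto
    ultimately show ?thesis by linarith
  qed
  have bd: "2 * (norm (x - y n))\<^sup>2 \<le> 2 * d\<^sup>2 + (4 * d + 2) * (1 / real (Suc n))" for n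
  proof -
    define t where "t = 1 / real (Suc n)"
    have t: "0 \<le> t" "t \<le> 1" unfolding t_def by auto
    have "(norm (x - y n))\<^sup>2 \<le> (d + t)\<^sup>2"
      using y[of n] unfolding t_def by (intro power_mono) auto
    also have "\<dots> = d\<^sup>2 + 2 * d * t + t * t"
      by (simp add: power2_eq_square algebra_simps)
    also have "t * t \<le> 1 * t" using t by (intro mult_right_mono)
    finally show ?thesis unfolding t_def[symmetric] by (simp add: algebra_simps)
  qed
  have "Cauchy y"
  proof (rule metric_CauchyI)
    fix e :: real assume e: "e > 0"
    obtain N where N: "(8 * d + 4) / e\<^sup>2 < real N"
      using reals_Archimedean2 by blast
    have "dist (y m) (y n) < e" if "m \<ge> N" "n \<ge> N" for m n
    proof -
      have *: "(4 * d + 2) * (1 / real (Suc k)) < e\<^sup>2 / 2" if "k \<ge> N" for k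
      proof -
        have "(8 * d + 4) / e\<^sup>2 < real (Suc k)" using N that by linarith
        then show ?thesis using e by (simp add: field_simps)
      qed
      have "(norm (y m - y n))\<^sup>2 < e\<^sup>2"
        using par[of m n] bd[of m] bd[of n] *[OF that(1)] *[OF that(2)] by linarith
      then show ?thesis
        unfolding dist_norm using e by (intro power2_less_imp_less[of _ e]) auto
    qed
    then show "\<exists>M. \<forall>m\<ge>M. \<forall>n\<ge>M. dist (y m) (y n) < e" by blast
  qed
  then obtain l where l: "y \<longlonglongrightarrow> l"
    using Cauchy_convergent convergent_def by blast
  let ?z = "x - l"
  have "(\<lambda>n. norm (x - y n)) \<longlonglongrightarrow> norm ?z" by (intro tendsto_intros l)
  moreover have "(\<lambda>n. d + 1 / real (Suc n)) \<longlonglongrightarrow> d + 0"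
    by (intro tendsto_add tendsto_const LIMSEQ_Suc lim_inverse_n'[simplified inverse_eq_divide])
  ultimately have zd: "norm ?z \<le> d" using y by (intro LIMSEQ_le[of _ _ _ d]) (auto intro!: exI less_imp_le)
  have zmin: "d \<le> norm (?z - v)" if "v \<in> V" for v
  proof -
    have "(\<lambda>n. norm (x - y n - v)) \<longlonglongrightarrow> norm (?z - v)" by (intro tendsto_intros l)
    moreover have "d \<le> norm (x - y n - v)" for n
      using dle[of "y n + v"] that yV subspace_add[OF assms(1)] by (simp add: diff_diff_eq)
    ultimately show ?thesis by (intro LIMSEQ_le_const) auto
  qed
  have "inner v ?z = 0" if "v \<in> V" for v
  proof (cases "v = 0")
    case False
    \<comment> \<open>The minimiser over t of the squared norm of \<open>?z - t v\<close>; the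
      minimum would fall below \<open>d\<close> squared if \<open>inner v ?z\<close> were
      nonzero.\<close>
    let ?t = "inner v ?z / inner v v"
    have expand: "(norm (z - t *\<^sub>R v))\<^sup>2 = (norm z)\<^sup>2 - 2 * t * inner v z + t * t * inner v v" for z t
      by (simp add: power2_norm_eq_inner inner_diff_left inner_diff_right inner_commute algebra_simps)
    have vv: "inner v v > 0" using False by simp
    have "d\<^sup>2 \<le> (norm (?z - ?t *\<^sub>R v))\<^sup>2"
      using zmin[of "?t *\<^sub>R v"] that subspace_scale[OF assms(1)] d0 by (intro power_mono) auto
    also have "\<dots> = (norm ?z)\<^sup>2 - 2 * ?t * inner v ?z + ?t * ?t * inner v v"
      by (rule expand)
    also have "\<dots> = (norm ?z)\<^sup>2 - (inner v ?z)\<^sup>2 / inner v v"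
      using vv by (simp add: power2_eq_square)
    also have "\<dots> \<le> d\<^sup>2 - (inner v ?z)\<^sup>2 / inner v v"
      using zd by (simp add: power_mono)
    finally have "(inner v ?z)\<^sup>2 / inner v v \<le> 0" by simp
    then show ?thesis using vv by (simp add: divide_le_0_iff)
  qed simp
  moreover have "?z \<noteq> 0" using zmin[of 0] subspace_0[OF assms(1)] d0 by auto
  ultimately show ?thesis by blast
qed

text \<open>This makes the choice in \<open>rtrace\<close> denote an actual basis. A maximal
  orthonormal set has dense span, since a nonzero vector orthogonal to it could be normalised and
  added.\<close>

lemma orthonormal_basis_exists:
  "\<exists>B :: 'h::{real_inner,complete_space} set. orthonormal_basis B"
proof -
  have "\<exists>M\<in>{B :: 'h set. orthonormal_set B}. \<forall>X\<in>{B. orthonormal_set B}. M \<subseteq> X \<longrightarrow> X = M"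
  proof (rule subset_Zorn')
    fix C :: "'h set set" assume "subset.chain {B. orthonormal_set B} C"
    then have C: "\<And>B. B \<in> C \<Longrightarrow> orthonormal_set B" "\<And>B D. B \<in> C \<Longrightarrow> D \<in> C \<Longrightarrow> B \<subseteq> D \<or> D \<subseteq> B"
      unfolding subset_chain_def by auto
    have "orthonormal_set (\<Union>C)"
      unfolding orthonormal_set_def
    proof (intro conjI ballI impI)
      fix e assume "e \<in> \<Union>C"
      then show "norm e = 1" using C(1) unfolding orthonormal_set_def by blast
    next
      fix e f assume "e \<in> \<Union>C" "f \<in> \<Union>C" "e \<noteq> f"
      then obtain B where "B \<in> C" "e \<in> B" "f \<in> B" using C(2) by blast
      then show "inner e f = 0" using C(1) \<open>e \<noteq> f\<close> unfolding orthonormal_set_def by blast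
    qed
    then show "\<Union>C \<in> {B. orthonormal_set B}" by simp
  qed
  then obtain B :: "'h set" where B: "orthonormal_set B"
    and max: "\<And>D. orthonormal_set D \<Longrightarrow> B \<subseteq> D \<Longrightarrow> D = B" by blast
  have "closure (span B) = UNIV"
  proof (rule ccontr)
    assume "closure (span B) \<noteq> UNIV"
    then obtain z where z: "z \<noteq> 0" "\<And>v. v \<in> span B \<Longrightarrow> inner v z = 0"
      using orthogonal_to_closed_subspace_exists[of "span B"] by blast
    let ?u = "z /\<^sub>R norm z"
    have "orthonormal_set (insert ?u B)"
      using B z span_base[of _ B] unfolding orthonormal_set_def by (auto simp: inner_commute)
    then have "?u \<in> B" using max by blast
    then have "inner ?u z = 0" using z span_base by blast
    then show False using z by simp
  qed
  with B show ?thesis by (intro exI[of _ B]) (simp add: orthonormal_basis_def orthonormal_set_def)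
qed

text \<open>Once \<open>F\<close> carries an approximant of \<open>x\<close>, best approximation
  makes the projection onto any larger finite set at least as close as that approximant.\<close>

lemma proj_on_tendsto:
  assumes "orthonormal_basis B"
  shows "((\<lambda>F. norm (x - proj_on F x)) \<longlongrightarrow> 0) (finite_subsets_at_top B)"
proof (rule tendstoI)
  fix \<epsilon> :: real assume "\<epsilon> > 0"
  have B: "orthonormal_set B" and "x \<in> closure (span B)"
    using assms unfolding orthonormal_basis_def orthonormal_set_def by auto
  then obtain y where y: "y \<in> span B" "dist y x < \<epsilon>"
    using \<open>\<epsilon> > 0\<close> closure_approachable by blast
  obtain F c where F: "finite F" "F \<subseteq> B" and c: "y = (\<Sum>e\<in>F. c e *\<^sub>R e)"
    using y(1) unfolding span_explicit by blast
  have yF: "y \<in> span F"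
    unfolding c by (intro span_sum span_scale span_base)
  have "norm (x - proj_on G x) < \<epsilon>" if "finite G" "F \<subseteq> G" "G \<subseteq> B" for G
    using proj_on_best_approx[of G y x] that F y yF span_mono[of F G] orthonormal_set_subset[OF B]
    by (force simp: dist_norm norm_minus_commute)
  then show "\<forall>\<^sub>F F in finite_subsets_at_top B. dist (norm (x - proj_on F x)) 0 < \<epsilon>"
    unfolding eventually_finite_subsets_at_top using F by (intro exI[of _ F]) auto
qed

section \<open>Traces of nuclear operators\<close>

text \<open>Absolute convergence, with \<open>complete_space\<close> as a separate class in the sort
  because \<open>{real_inner, complete_space}\<close> does not entail \<open>banach\<close>.\<close>

lemma summable_norm_imp_summable:
  fixes v :: "nat \<Rightarrow> 'h::{real_normed_vector,complete_space}"
  assumes "summable (\<lambda>n. norm (v n))"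
  shows "summable v"
proof -
  let ?X = "\<lambda>n. \<Sum>i<n. v i" and ?Y = "\<lambda>n. \<Sum>i<n. norm (v i)"
  have Y: "Cauchy ?Y"
    using assms by (simp add: summable_iff_convergent Cauchy_convergent_iff)
  have *: "dist (?X m) (?X n) \<le> dist (?Y m) (?Y n)" if "m \<le> n" for m n
  proof -
    have "?X n = ?X m + (\<Sum>i\<in>{m..<n}. v i)" "?Y n = ?Y m + (\<Sum>i\<in>{m..<n}. norm (v i))"
      using that by (metis sum.atLeastLessThan_concat lessThan_atLeast0 le0)+
    then show ?thesis
      by (simp add: dist_norm norm_sum sum_nonneg abs_of_nonneg)
  qed
  have "dist (?X m) (?X n) \<le> dist (?Y m) (?Y n)" for m n
    using *[of m n] *[of n m] by (cases "m \<le> n") (auto simp: dist_commute)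
  then have "Cauchy ?X"
    using Y unfolding Cauchy_def by (meson le_less_trans)
  then show ?thesis
    by (simp add: summable_iff_convergent Cauchy_convergent)
qed

text \<open>A nuclear representation is one sequence, so adding two operators requires merging their
  sequences into one.\<close>

definition interleave :: "(nat \<Rightarrow> 'a) \<Rightarrow> (nat \<Rightarrow> 'a) \<Rightarrow> nat \<Rightarrow> 'a" where
  "interleave u v n = (if even n then u (n div 2) else v (n div 2))"

lemma sums_interleave:
  fixes u v :: "nat \<Rightarrow> 'a::real_normed_vector"
  assumes "u sums x" "v sums y"
  shows "interleave u v sums (x + y)"
proof -
  \<comment> \<open>Below \<open>n\<close> the number of even indices is n/2 rounded up, that of odd
    indices n/2 rounded down.\<close>
  have eq: "(\<Sum>i<n. interleave u v i) = (\<Sum>i<(n + 1) div 2. u i) + (\<Sum>i<n div 2. v i)" for n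
  proof (induction n)
    case (Suc n)
    show ?case
    proof (cases "even n")
      case True
      then have "(Suc n + 1) div 2 = Suc (n div 2)" "(n + 1) div 2 = n div 2" "Suc n div 2 = n div 2"
        by auto
      then show ?thesis using Suc True by (simp add: interleave_def)
    next
      case False
      then have "(Suc n + 1) div 2 = (n + 1) div 2" "Suc n div 2 = Suc (n div 2)"
        by (auto elim!: oddE)
      then show ?thesis using Suc False by (simp add: interleave_def)
    qed
  qed simp
  have lim: "filterlim (\<lambda>n. (n + 1) div 2) at_top sequentially" "filterlim (\<lambda>n::nat. n div 2) at_top sequentially"
    unfolding filterlim_at_top eventually_at_top_linorder
    by (metis div_le_mono nonzero_mult_div_cancel_left trans_le_add1 zero_neq_numeral,
        metis div_le_mono nonzero_mult_div_cancel_left zero_neq_numeral)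
  show ?thesis
    using tendsto_add[OF filterlim_compose[OF assms(1)[unfolded sums_def] lim(1)]
        filterlim_compose[OF assms(2)[unfolded sums_def] lim(2)]]
    unfolding sums_def eq .
qed

lemma interleave_map2: "f (interleave a c n) (interleave b d n) = interleave (\<lambda>n. f (a n) (b n)) (\<lambda>n. f (c n) (d n)) n"
  by (simp add: interleave_def)

lemma nuclear_rep_sums:
  fixes T :: "'h::{real_inner,complete_space} \<Rightarrow>\<^sub>L 'h"
  assumes "nuclear_rep T a b"
  shows "(\<lambda>n. inner (b n) x *\<^sub>R a n) sums T x"
proof -
  have "summable (\<lambda>n. norm x * (norm (a n) * norm (b n)))"
    using assms unfolding nuclear_rep_def by (intro summable_mult) auto
  then have "summable (\<lambda>n. norm (inner (b n) x *\<^sub>R a n))"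
  proof (rule summable_comparison_test[rotated], intro exI allI impI)
    fix n
    have "\<bar>inner (b n) x\<bar> * norm (a n) \<le> (norm (b n) * norm x) * norm (a n)"
      by (intro mult_right_mono Cauchy_Schwarz_ineq2) auto
    then show "norm (norm (inner (b n) x *\<^sub>R a n)) \<le> norm x * (norm (a n) * norm (b n))"
      by (simp add: mult_ac)
  qed
  then show ?thesis
    using assms summable_norm_imp_summable summable_sums unfolding nuclear_rep_def by fastforce
qed

lemma nuclear_repI:
  fixes T :: "'h::real_inner \<Rightarrow>\<^sub>L 'h"
  assumes "summable (\<lambda>n. norm (a n) * norm (b n))" "\<And>x. (\<lambda>n. inner (b n) x *\<^sub>R a n) sums T x"
  shows "nuclear_rep T a b"
  using assms sums_unique unfolding nuclear_rep_def by blast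

lemma nuclear_rep_add:
  fixes S T :: "'h::{real_inner,complete_space} \<Rightarrow>\<^sub>L 'h"
  assumes "nuclear_rep S a b" "nuclear_rep T c d"
  shows "nuclear_rep (S + T) (interleave a c) (interleave b d)"
proof (rule nuclear_repI)
  show "summable (\<lambda>n. norm (interleave a c n) * norm (interleave b d n))"
    unfolding interleave_map2[of "\<lambda>x y. norm x * norm y"]
    using assms unfolding nuclear_rep_def
    by (intro sums_summable[OF sums_interleave[OF summable_sums summable_sums]]) simp_all
  show "(\<lambda>n. inner (interleave b d n) x *\<^sub>R interleave a c n) sums (S + T) x" for x
    unfolding interleave_map2[of "\<lambda>u v. inner u x *\<^sub>R v"] blinfun.add_left
    by (intro sums_interleave nuclear_rep_sums assms)
qed

lemma nuclear_rep_compose: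
  fixes T :: "'h::{real_inner,complete_space} \<Rightarrow>\<^sub>L 'h"
  assumes "nuclear_rep T a b"
  shows "nuclear_rep (A o\<^sub>L T) (\<lambda>n. A (a n)) b"
    and "summable (\<lambda>n. norm (A (a n)) * norm (b n))"
    and "(\<Sum>n. norm (A (a n)) * norm (b n)) \<le> norm A * (\<Sum>n. norm (a n) * norm (b n))"
proof -
  have s: "summable (\<lambda>n. norm A * (norm (a n) * norm (b n)))"
    using assms unfolding nuclear_rep_def by (intro summable_mult) auto
  have le: "norm (A (a n)) * norm (b n) \<le> norm A * (norm (a n) * norm (b n))" for n
    using mult_right_mono[OF norm_blinfun[of A "a n"], of "norm (b n)"] by (simp add: mult_ac)
  show sA: "summable (\<lambda>n. norm (A (a n)) * norm (b n))"
    by (rule summable_comparison_test[OF _ s]) (use le in auto)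
  show "(\<Sum>n. norm (A (a n)) * norm (b n)) \<le> norm A * (\<Sum>n. norm (a n) * norm (b n))"
    using suminf_le[OF le sA s] assms unfolding nuclear_rep_def by (simp add: suminf_mult)
  have "(\<lambda>n. A (inner (b n) x *\<^sub>R a n)) sums A (T x)" for x
    using nuclear_rep_sums[OF assms] by (rule bounded_linear.sums[OF blinfun.bounded_linear_right])
  then show "nuclear_rep (A o\<^sub>L T) (\<lambda>n. A (a n)) b"
    using sA by (intro nuclear_repI) (auto simp: blinfun.scaleR_right)
qed

lemma trace_class_compose:
  fixes T :: "'h::{real_inner,complete_space} \<Rightarrow>\<^sub>L 'h"
  shows "trace_class T \<Longrightarrow> trace_class (A o\<^sub>L T)"
  using nuclear_rep_compose(1) unfolding trace_class_def by blast

lemma trace_class_add: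
  fixes S T :: "'h::{real_inner,complete_space} \<Rightarrow>\<^sub>L 'h"
  shows "trace_class S \<Longrightarrow> trace_class T \<Longrightarrow> trace_class (S + T)"
  using nuclear_rep_add unfolding trace_class_def by blast

lemma trace_class_scaleR:
  fixes T :: "'h::{real_inner,complete_space} \<Rightarrow>\<^sub>L 'h"
  assumes "trace_class T" shows "trace_class (c *\<^sub>R T)"
proof -
  have "c *\<^sub>R T = (c *\<^sub>R id_blinfun) o\<^sub>L T"
    by (rule blinfun_eqI) (simp add: blinfun.scaleR_left)
  then show ?thesis using trace_class_compose[OF assms] by simp
qed

lemma trace_class_diff:
  fixes S T :: "'h::{real_inner,complete_space} \<Rightarrow>\<^sub>L 'h"
  assumes "trace_class S" "trace_class T" shows "trace_class (S - T)"
  using trace_class_add[OF assms(1) trace_class_scaleR[OF assms(2), of "-1"]] by simp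

section \<open>The real trace and its bound by nuclear representations\<close>

lemma nuclear_rep_inner_sums:
  fixes T :: "'h::{real_inner,complete_space} \<Rightarrow>\<^sub>L 'h"
  assumes "nuclear_rep T a b"
  shows "(\<lambda>n. inner (b n) x * inner y (a n)) sums inner y (T x)"
  using bounded_linear.sums[OF bounded_linear_inner_right nuclear_rep_sums[OF assms]] by simp

text \<open>Bessel and Cauchy-Schwarz bound the diagonal of each rank-one term by
  \<open>norm (a n) * norm (b n)\<close>. The bound is uniform in \<open>F\<close>, which later
  yields absolute summability over \<open>trace_basis\<close>.\<close>

lemma nuclear_rep_diagonal_bound:
  fixes T :: "'h::{real_inner,complete_space} \<Rightarrow>\<^sub>L 'h"
  assumes T: "nuclear_rep T a b" and F: "orthonormal_set F" "finite F"
  shows "(\<Sum>e\<in>F. \<bar>inner e (T e)\<bar>) \<le> (\<Sum>n. norm (a n) * norm (b n))"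
proof -
  have s: "summable (\<lambda>n. norm (a n) * norm (b n))" using T unfolding nuclear_rep_def by blast
  have le: "\<bar>inner e (a n) * inner e (b n)\<bar> \<le> norm (a n) * norm (b n)" if "e \<in> F" for e n
    using Bessel_Cauchy_Schwarz[OF F, of "a n" "b n"] that F(2)
      member_le_sum[of e F "\<lambda>e. \<bar>inner e (a n) * inner e (b n)\<bar>"] by fastforce
  have sabs: "summable (\<lambda>n. \<bar>inner e (a n) * inner e (b n)\<bar>)" if "e \<in> F" for e
    by (rule summable_comparison_test[OF _ s]) (use le[OF that] in auto)
  have "(\<Sum>e\<in>F. \<bar>inner e (T e)\<bar>) \<le> (\<Sum>e\<in>F. \<Sum>n. \<bar>inner e (a n) * inner e (b n)\<bar>)"
  proof (rule sum_mono)
    fix e assume "e \<in> F"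
    have "inner e (T e) = (\<Sum>n. inner e (a n) * inner e (b n))"
      using sums_unique[OF nuclear_rep_inner_sums[OF T, of e e]] by (simp add: inner_commute mult.commute)
    then show "\<bar>inner e (T e)\<bar> \<le> (\<Sum>n. \<bar>inner e (a n) * inner e (b n)\<bar>)"
      using summable_rabs[OF sabs[OF \<open>e \<in> F\<close>]] by simp
  qed
  also have "\<dots> = (\<Sum>n. \<Sum>e\<in>F. \<bar>inner e (a n) * inner e (b n)\<bar>)"
    by (rule suminf_sum[symmetric]) (rule sabs)
  also have "\<dots> \<le> (\<Sum>n. norm (a n) * norm (b n))"
    by (rule suminf_le[OF Bessel_Cauchy_Schwarz[OF F] summable_sum[OF sabs] s])
  finally show ?thesis .
qed

definition trace_basis :: "'h::real_inner set" where
  "trace_basis = (SOME B. orthonormal_basis B)"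

lemma orthonormal_basis_trace_basis: "orthonormal_basis (trace_basis :: 'h::{real_inner,complete_space} set)"
  unfolding trace_basis_def using orthonormal_basis_exists by (rule someI_ex)

lemma orthonormal_set_trace_basis: "orthonormal_set (trace_basis :: 'h::{real_inner,complete_space} set)"
  using orthonormal_basis_trace_basis unfolding orthonormal_basis_def orthonormal_set_def by blast

lemma rtrace_eq:
  fixes T :: "'h::real_inner \<Rightarrow>\<^sub>L 'h"
  shows "rtrace T = infsum (\<lambda>e. inner e (T e)) trace_basis"
  unfolding rtrace_def trace_basis_def ..

lemma nuclear_rep_rtrace:
  fixes T :: "'h::{real_inner,complete_space} \<Rightarrow>\<^sub>L 'h"
  assumes "nuclear_rep T a b"
  shows "(\<lambda>e. inner e (T e)) summable_on trace_basis"
    and "\<bar>rtrace T\<bar> \<le> (\<Sum>n. norm (a n) * norm (b n))"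
proof -
  have bd: "(\<Sum>e\<in>F. \<bar>inner e (T e)\<bar>) \<le> (\<Sum>n. norm (a n) * norm (b n))"
    if "finite F" "F \<subseteq> trace_basis" for F
    using nuclear_rep_diagonal_bound[OF assms] orthonormal_set_subset[OF orthonormal_set_trace_basis that(2)] that
    by blast
  have abs: "(\<lambda>e. \<bar>inner e (T e)\<bar>) summable_on trace_basis"
    by (rule nonneg_bdd_above_summable_on) (use bd in \<open>auto intro!: bdd_aboveI2\<close>)
  then show "(\<lambda>e. inner e (T e)) summable_on trace_basis"
    using summable_on_iff_abs_summable_on_real by force
  have "\<bar>rtrace T\<bar> \<le> infsum (\<lambda>e. \<bar>inner e (T e)\<bar>) trace_basis"
    unfolding rtrace_eq using norm_infsum_bound[of "\<lambda>e. inner e (T e)" trace_basis] abs by simp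
  also have "\<dots> \<le> (\<Sum>n. norm (a n) * norm (b n))"
    by (rule infsum_le_finite_sums[OF abs bd])
  finally show "\<bar>rtrace T\<bar> \<le> (\<Sum>n. norm (a n) * norm (b n))" .
qed

lemma trace_class_summable_on:
  fixes T :: "'h::{real_inner,complete_space} \<Rightarrow>\<^sub>L 'h"
  shows "trace_class T \<Longrightarrow> (\<lambda>e. inner e (T e)) summable_on trace_basis"
  using nuclear_rep_rtrace(1) unfolding trace_class_def by blast

lemma rtrace_add:
  fixes S T :: "'h::{real_inner,complete_space} \<Rightarrow>\<^sub>L 'h"
  assumes "trace_class S" "trace_class T"
  shows "rtrace (S + T) = rtrace S + rtrace T"
  unfolding rtrace_eq
  by (simp add: blinfun.add_left inner_add_right infsum_add trace_class_summable_on assms)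

lemma rtrace_scaleR:
  fixes T :: "'h::real_inner \<Rightarrow>\<^sub>L 'h"
  shows "rtrace (c *\<^sub>R T) = c * rtrace T"
  unfolding rtrace_eq by (simp add: blinfun.scaleR_left infsum_cmult_right')

lemma rtrace_diff:
  fixes S T :: "'h::{real_inner,complete_space} \<Rightarrow>\<^sub>L 'h"
  assumes "trace_class S" "trace_class T"
  shows "rtrace (S - T) = rtrace S - rtrace T"
  using rtrace_add[OF assms(1) trace_class_scaleR[OF assms(2), of "-1"]] rtrace_scaleR[of "-1" T] by simp

text \<open>The bound holds for each representation of \<open>T\<close>. Dividing by
  \<open>norm A\<close> lets it pass to the infimum, hence the separate case of a vanishing
  \<open>A\<close>.\<close>

lemma rtrace_compose_le_trace_norm:
  fixes A T :: "'h::{real_inner,complete_space} \<Rightarrow>\<^sub>L 'h"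
  assumes "trace_class T"
  shows "\<bar>rtrace (A o\<^sub>L T)\<bar> \<le> norm A * trace_norm T"
proof -
  have le: "\<bar>rtrace (A o\<^sub>L T)\<bar> \<le> norm A * (\<Sum>n. norm (a n) * norm (b n))" if "nuclear_rep T a b" for a b
    using nuclear_rep_rtrace(2)[OF nuclear_rep_compose(1)[OF that]] nuclear_rep_compose(3)[OF that]
    by (rule order_trans)
  show ?thesis
  proof (cases "norm A = 0")
    case True
    then show ?thesis using le assms unfolding trace_class_def by force
  next
    case False
    then have A: "norm A > 0" by simp
    have "\<bar>rtrace (A o\<^sub>L T)\<bar> / norm A \<le> trace_norm T"
      unfolding trace_norm_def
      using assms le A unfolding trace_class_def by (intro cInf_greatest) (auto simp: field_simps)
    then show ?thesis using A by (simp add: field_simps)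
  qed
qed

text \<open>Cholesky: split off the rank-one part determined by one row and induct on what remains.\<close>

lemma positive_semidefinite_decomposition:
  fixes R :: "'a \<Rightarrow> 'a \<Rightarrow> real"
  assumes "finite F" "\<And>e f. R e f = R f e"
    and "\<And>c. (\<Sum>e\<in>F. \<Sum>f\<in>F. c e * c f * R e f) \<ge> 0"
  shows "\<exists>w. \<forall>e\<in>F. \<forall>f\<in>F. R e f = (\<Sum>k\<in>F. w k e * w k f)"
  using assms
proof (induction F arbitrary: R rule: finite_induct)
  case empty
  then show ?case by simp
next
  case (insert g F)
  note sym = insert.prems(1)
  have expand: "(\<Sum>e\<in>insert g F. \<Sum>f\<in>insert g F. c e * c f * R e f)
      = (c g)\<^sup>2 * R g g + 2 * c g * (\<Sum>e\<in>F. c e * R g e) + (\<Sum>e\<in>F. \<Sum>f\<in>F. c e * c f * R e f)" for c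
  proof -
    have "(\<Sum>e\<in>F. c e * c g * R e g) = c g * (\<Sum>e\<in>F. c e * R g e)"
      unfolding sum_distrib_left by (intro sum.cong refl) (subst sym, simp add: mult_ac)
    moreover have "(\<Sum>f\<in>F. c g * c f * R g f) = c g * (\<Sum>e\<in>F. c e * R g e)"
      unfolding sum_distrib_left by (intro sum.cong refl) (simp add: mult_ac)
    ultimately show ?thesis
      using insert.hyps by (simp add: sum.distrib power2_eq_square)
  qed
  have gg: "R g g \<ge> 0"
  proof -
    have "(\<Sum>e\<in>F. (if e = g then 1 else 0) * R g e) = (0::real)"
      "(\<Sum>e\<in>F. \<Sum>f\<in>F. (if e = g then 1 else 0) * (if f = g then 1 else 0) * R e f) = (0::real)"
      using insert.hyps by (auto intro!: sum.neutral)
    then show ?thesis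
      using insert.prems(2)[of "\<lambda>e. if e = g then 1 else 0"] expand[of "\<lambda>e. if e = g then 1 else 0"] by simp
  qed
  have row: "R g e = 0" if "R g g = 0" "e \<in> F" for e
  proof (rule ccontr)
    assume nz: "R g e \<noteq> 0"
    \<comment> \<open>Chosen so that the quadratic form takes the value -1 at the vector with entry
      \<open>t\<close> at \<open>g\<close> and 1 at \<open>e\<close>.\<close>
    define t where "t = - (R e e + 1) / (2 * R g e)"
    define c where "c = (\<lambda>x. if x = g then t else if x = e then 1 else (0::real))"
    have ce: "c x = (if x = e then 1 else 0)" if "x \<in> F" for x
      using that insert.hyps unfolding c_def by auto
    have "(\<Sum>x\<in>F. c x * R g x) = R g e"
      using insert.hyps \<open>e \<in> F\<close> by (simp add: ce if_distrib[of "\<lambda>x. x * _"] cong: sum.cong if_cong)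
    moreover have "(\<Sum>x\<in>F. \<Sum>y\<in>F. c x * c y * R x y) = R e e"
    proof -
      have "(\<Sum>x\<in>F. \<Sum>y\<in>F. c x * c y * R x y) = (\<Sum>x\<in>F. \<Sum>y\<in>F. if y = e then (if x = e then R x y else 0) else 0)"
        by (intro sum.cong) (auto simp: ce)
      also have "\<dots> = R e e" using insert.hyps \<open>e \<in> F\<close> by simp
      finally show ?thesis .
    qed
    moreover have "c g = t" unfolding c_def by simp
    ultimately have "2 * t * R g e + R e e \<ge> 0"
      using insert.prems(2)[of c] expand[of c] \<open>R g g = 0\<close> by simp
    moreover have "2 * t * R g e = - (R e e + 1)" using nz unfolding t_def by (simp add: field_simps)
    ultimately show False by simp
  qed
  \<comment> \<open>If \<open>R g g = 0\<close>, division by zero makes \<open>u\<close> vanish,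
    which is consistent because the whole row then vanishes.\<close>
  define u where "u e = R g e / sqrt (R g g)" for e
  define R' where "R' e f = R e f - u e * u f" for e f
  have ug: "u g * u e = R g e" if "e \<in> insert g F" for e
  proof (cases "R g g = 0")
    case True
    then show ?thesis using row that by (auto simp: u_def)
  next
    case False
    then show ?thesis using gg by (simp add: u_def field_simps)
  qed
  have "(\<Sum>e\<in>F. \<Sum>f\<in>F. c e * c f * R' e f) \<ge> 0" for c
  proof -
    define s where "s = (\<Sum>e\<in>F. c e * R g e)"
    \<comment> \<open>The entry at \<open>g\<close> minimises the form for given \<open>c\<close> on
      \<open>F\<close>; completing the square leaves the Schur complement \<open>R'\<close>. For
      \<open>R g g = 0\<close> the entry defaults to 0.\<close>
    define c' where "c' = c(g := - s / R g g)"
    have c': "c' x = c x" if "x \<in> F" for x using that insert.hyps unfolding c'_def by auto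
    have su: "(\<Sum>e\<in>F. c e * u e) = s / sqrt (R g g)"
      unfolding s_def u_def by (simp add: sum_divide_distrib)
    have "(\<Sum>e\<in>F. \<Sum>f\<in>F. c e * c f * R' e f)
        = (\<Sum>e\<in>F. \<Sum>f\<in>F. c e * c f * R e f) - (\<Sum>e\<in>F. c e * u e) * (\<Sum>e\<in>F. c e * u e)"
      unfolding R'_def by (simp add: sum_subtractf sum_product algebra_simps)
    also have "\<dots> = (\<Sum>e\<in>F. \<Sum>f\<in>F. c e * c f * R e f) - s\<^sup>2 / R g g"
      using gg by (simp add: su power2_eq_square)
    also have "\<dots> = (\<Sum>e\<in>insert g F. \<Sum>f\<in>insert g F. c' e * c' f * R e f)"
    proof -
      have "(\<Sum>e\<in>F. c' e * R g e) = s"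
        unfolding s_def by (intro sum.cong refl) (simp add: c')
      moreover have "c' g = - s / R g g"
        by (simp add: c'_def)
      moreover have "(\<Sum>e\<in>F. \<Sum>f\<in>F. c' e * c' f * R e f) = (\<Sum>e\<in>F. \<Sum>f\<in>F. c e * c f * R e f)"
        by (intro sum.cong) (auto simp: c')
      ultimately show ?thesis
        unfolding expand by (cases "R g g = 0") (auto simp: power2_eq_square field_simps)
    qed
    finally show ?thesis using insert.prems(2)[of c'] by simp
  qed
  moreover have "R' e f = R' f e" for e f unfolding R'_def by (simp add: sym mult.commute)
  ultimately obtain w where w: "\<And>e f. e \<in> F \<Longrightarrow> f \<in> F \<Longrightarrow> R' e f = (\<Sum>k\<in>F. w k e * w k f)"
    using insert.IH[of R'] by blast
  \<comment> \<open>Index \<open>g\<close> contributes the row split off; the vectors from the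
    induction are extended by 0 at \<open>g\<close>.\<close>
  define w' where "w' k e = (if k = g then u e else if e = g then 0 else w k e)" for k e
  have "R e f = (\<Sum>k\<in>insert g F. w' k e * w' k f)" if "e \<in> insert g F" "f \<in> insert g F" for e f
  proof -
    have "(\<Sum>k\<in>insert g F. w' k e * w' k f) = u e * u f + (\<Sum>k\<in>F. w' k e * w' k f)"
      using insert.hyps by (simp add: w'_def)
    also have "(\<Sum>k\<in>F. w' k e * w' k f) = (if e = g \<or> f = g then 0 else R' e f)"
    proof (cases "e = g \<or> f = g")
      case True
      then show ?thesis using insert.hyps by (auto simp: w'_def intro!: sum.neutral)
    next
      case False
      then show ?thesis using that w insert.hyps by (auto simp: w'_def intro!: sum.cong)
    qed
    also have "u e * u f + (if e = g \<or> f = g then 0 else R' e f) = R e f"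
      using ug that sym by (auto simp: R'_def mult.commute)
    finally show ?thesis by simp
  qed
  then show ?case by blast
qed

text \<open>Compressed to the span of \<open>F\<close>, \<rho> is a positive semidefinite matrix and
  hence a sum of rank-one squares of vectors \<open>x k\<close>. The left-hand trace becomes the sum
  of \<open>inner (x k) (X (x k))\<close>, while the squared norms of the \<open>x k\<close> add up
  to the sum on the right. Cauchy-Schwarz then handles an arbitrary \<open>X\<close>.\<close>

lemma finite_trace_bound:
  fixes X \<rho> :: "'h::{real_inner,complete_space} \<Rightarrow>\<^sub>L 'h"
  assumes F: "orthonormal_set F" "finite F"
    and sa: "self_adjoint_op \<rho>" and pos: "\<forall>x. inner x (\<rho> x) \<ge> 0"
  shows "\<bar>\<Sum>e\<in>F. inner e (X (proj_on F (\<rho> e)))\<bar> \<le> norm X * (\<Sum>e\<in>F. inner e (\<rho> e))"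
proof -
  define R where "R e f = inner e (\<rho> f)" for e f
  have symR: "R e f = R f e" for e f
    using sa unfolding R_def self_adjoint_op_def by (simp add: inner_commute)
  have "(\<Sum>e\<in>F. \<Sum>f\<in>F. c e * c f * R e f) \<ge> 0" for c
  proof -
    have "inner (\<Sum>e\<in>F. c e *\<^sub>R e) (\<rho> (\<Sum>e\<in>F. c e *\<^sub>R e)) = (\<Sum>e\<in>F. \<Sum>f\<in>F. c e * c f * R e f)"
      unfolding inner_sum_left blinfun.sum_right inner_sum_right blinfun.scaleR_right
      by (intro sum.cong refl) (auto simp: R_def intro: symR[unfolded R_def])
    then show ?thesis using pos by metis
  qed
  then obtain w where w: "\<And>e f. e \<in> F \<Longrightarrow> f \<in> F \<Longrightarrow> R e f = (\<Sum>k\<in>F. w k e * w k f)"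
    using positive_semidefinite_decomposition[of F R] F(2) symR by blast
  define x where "x k = (\<Sum>e\<in>F. w k e *\<^sub>R e)" for k
  have nx: "(norm (x k))\<^sup>2 = (\<Sum>e\<in>F. (w k e)\<^sup>2)" for k
    unfolding x_def by (rule norm_orthonormal_sum[OF F])
  have "(\<Sum>e\<in>F. inner e (X (proj_on F (\<rho> e)))) = (\<Sum>e\<in>F. \<Sum>f\<in>F. R f e * inner e (X f))"
    unfolding proj_on_def R_def
    by (simp add: blinfun.sum_right blinfun.scaleR_right inner_sum_right)
  also have "\<dots> = (\<Sum>e\<in>F. \<Sum>f\<in>F. \<Sum>k\<in>F. w k e * w k f * inner e (X f))"
    by (intro sum.cong refl) (simp add: w sum_distrib_left sum_distrib_right mult_ac)
  also have "\<dots> = (\<Sum>e\<in>F. \<Sum>k\<in>F. \<Sum>f\<in>F. w k e * w k f * inner e (X f))"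
    by (intro sum.cong refl sum.swap)
  also have "\<dots> = (\<Sum>k\<in>F. \<Sum>e\<in>F. \<Sum>f\<in>F. w k e * w k f * inner e (X f))"
    by (rule sum.swap)
  also have "\<dots> = (\<Sum>k\<in>F. inner (x k) (X (x k)))"
    unfolding x_def inner_sum_left blinfun.sum_right inner_sum_right blinfun.scaleR_right
    by (rule sum.cong[OF refl], subst sum.swap) (simp add: mult_ac)
  finally have eq: "(\<Sum>e\<in>F. inner e (X (proj_on F (\<rho> e)))) = (\<Sum>k\<in>F. inner (x k) (X (x k)))" .
  have "\<bar>\<Sum>k\<in>F. inner (x k) (X (x k))\<bar> \<le> (\<Sum>k\<in>F. norm X * (norm (x k))\<^sup>2)"
  proof (rule order_trans[OF sum_abs sum_mono])
    fix k
    have "\<bar>inner (x k) (X (x k))\<bar> \<le> norm (x k) * norm (X (x k))" by (rule Cauchy_Schwarz_ineq2)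
    also have "\<dots> \<le> norm (x k) * (norm X * norm (x k))" by (intro mult_left_mono norm_blinfun) auto
    finally show "\<bar>inner (x k) (X (x k))\<bar> \<le> norm X * (norm (x k))\<^sup>2"
      by (simp add: power2_eq_square mult_ac)
  qed
  also have "\<dots> = norm X * (\<Sum>k\<in>F. \<Sum>e\<in>F. (w k e)\<^sup>2)" by (simp add: nx sum_distrib_left)
  also have "(\<Sum>k\<in>F. \<Sum>e\<in>F. (w k e)\<^sup>2) = (\<Sum>e\<in>F. \<Sum>k\<in>F. (w k e)\<^sup>2)" by (rule sum.swap)
  also have "\<dots> = (\<Sum>e\<in>F. inner e (\<rho> e))"
    using w by (intro sum.cong) (auto simp: R_def power2_eq_square)
  finally show ?thesis unfolding eq .
qed

text \<open>For a finite part \<open>F\<close> of the basis, \<rho> is split into its projection to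
  the span of \<open>F\<close> and the residual. The first part falls under
  \<open>finite_trace_bound\<close>; the second has a nuclear representation whose total weight
  tends to 0 as \<open>F\<close> grows.\<close>

lemma rtrace_compose_positive_bound:
  fixes X \<rho> :: "'h::{real_inner,complete_space} \<Rightarrow>\<^sub>L 'h"
  assumes tc: "trace_class \<rho>" and sa: "self_adjoint_op \<rho>" and pos: "\<forall>x. inner x (\<rho> x) \<ge> 0"
  shows "\<bar>rtrace (X o\<^sub>L \<rho>)\<bar> \<le> norm X * rtrace \<rho>"
proof -
  let ?B = "trace_basis :: 'h set"
  let ?FB = "finite_subsets_at_top ?B"
  obtain a b where ab: "nuclear_rep \<rho> a b" using tc unfolding trace_class_def by blast
  then have s: "summable (\<lambda>n. norm (a n) * norm (b n))" unfolding nuclear_rep_def by blast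
  have ev: "\<forall>\<^sub>F F in ?FB. finite F \<and> F \<subseteq> ?B"
    by (rule eventually_finite_subsets_at_top_weakI) auto
  \<comment> \<open>The weight of the n-th rank-one term of the residual. It tends to 0 along
    \<open>F\<close> and is dominated by the original weight, as Tannery's theorem requires.\<close>
  define r where "r F n = norm (a n - proj_on F (a n)) * norm (b n)" for F n
  have r_le: "r F n \<le> norm (a n) * norm (b n)" if "finite F" "F \<subseteq> ?B" for F n
    unfolding r_def
    using proj_on_best_approx[of F 0 "a n"] that orthonormal_set_subset[OF orthonormal_set_trace_basis]
    by (intro mult_right_mono) (auto simp: span_zero)
  have r0: "r F n \<ge> 0" for F n unfolding r_def by simp
  have r_lim: "((\<lambda>F. r F n) \<longlongrightarrow> 0) ?FB" for n
    unfolding r_def using proj_on_tendsto[OF orthonormal_basis_trace_basis]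
    by (intro tendsto_mult_left_zero)
  have "eventually (\<lambda>(n,F). norm (r F n) \<le> norm (a n) * norm (b n)) (at_top \<times>\<^sub>F ?FB)"
  proof -
    have "eventually (\<lambda>p. finite (snd p) \<and> snd p \<subseteq> ?B) (at_top \<times>\<^sub>F ?FB)"
      using filterlim_snd ev unfolding filterlim_iff by blast
    then show ?thesis by (rule eventually_mono) (use r_le r0 in auto)
  qed
  from tannerys_theorem[OF r_lim this s finite_subsets_at_top_neq_bot]
  have lim_r: "((\<lambda>F. suminf (r F)) \<longlongrightarrow> 0) ?FB" by simp
  have err: "\<bar>(\<Sum>e\<in>F. inner e (X (\<rho> e)))\<bar> \<le> norm X * rtrace \<rho> + norm X * suminf (r F)"
    if F: "finite F" "F \<subseteq> ?B" for F
  proof -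
    have on: "orthonormal_set F" using F orthonormal_set_subset[OF orthonormal_set_trace_basis] by blast
    have blp: "bounded_linear (\<lambda>x. x - proj_on F x)"
      unfolding proj_on_def by (intro bounded_linear_intros)
    have ap: "blinfun_apply (Blinfun (\<lambda>x. x - proj_on F x)) x = x - proj_on F x" for x
      using bounded_linear_Blinfun_apply[OF blp] by simp
    have "nuclear_rep ((X o\<^sub>L Blinfun (\<lambda>x. x - proj_on F x)) o\<^sub>L \<rho>) (\<lambda>n. X (a n - proj_on F (a n))) b"
      using nuclear_rep_compose(1)[OF ab, of "X o\<^sub>L Blinfun (\<lambda>x. x - proj_on F x)"] by (simp add: ap)
    note bd = nuclear_rep_diagonal_bound[OF this on F(1)]
    have "nuclear_rep (Blinfun (\<lambda>x. x - proj_on F x) o\<^sub>L \<rho>) (\<lambda>n. a n - proj_on F (a n)) b"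
      using nuclear_rep_compose(1)[OF ab, of "Blinfun (\<lambda>x. x - proj_on F x)"] by (simp add: ap)
    from nuclear_rep_compose(3)[OF this, of X]
    have bd2: "(\<Sum>e\<in>F. \<bar>inner e (X (\<rho> e - proj_on F (\<rho> e)))\<bar>) \<le> norm X * suminf (r F)"
      using bd unfolding r_def by (simp add: ap)
    have "(\<Sum>e\<in>F. inner e (X (\<rho> e)))
       = (\<Sum>e\<in>F. inner e (X (proj_on F (\<rho> e)))) + (\<Sum>e\<in>F. inner e (X (\<rho> e - proj_on F (\<rho> e))))"
      by (simp add: blinfun.diff_right inner_diff_right sum_subtractf)
    moreover have "\<bar>\<Sum>e\<in>F. inner e (X (\<rho> e - proj_on F (\<rho> e)))\<bar> \<le> norm X * suminf (r F)"
      using sum_abs bd2 by (rule order_trans)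
    moreover have "\<bar>\<Sum>e\<in>F. inner e (X (proj_on F (\<rho> e)))\<bar> \<le> norm X * rtrace \<rho>"
    proof (rule order_trans[OF finite_trace_bound[OF on F(1) sa pos]])
      have "(\<Sum>e\<in>F. inner e (\<rho> e)) \<le> rtrace \<rho>"
        unfolding rtrace_eq using pos F trace_class_summable_on[OF tc] by (intro finite_sum_le_infsum) auto
      then show "norm X * (\<Sum>e\<in>F. inner e (\<rho> e)) \<le> norm X * rtrace \<rho>" by (intro mult_left_mono) auto
    qed
    ultimately show ?thesis by linarith
  qed
  have "((\<lambda>e. inner e ((X o\<^sub>L \<rho>) e)) has_sum rtrace (X o\<^sub>L \<rho>)) ?B"
    unfolding rtrace_eq by (intro has_sum_infsum trace_class_summable_on trace_class_compose tc)
  then have "((\<lambda>F. \<bar>\<Sum>e\<in>F. inner e (X (\<rho> e))\<bar>) \<longlongrightarrow> \<bar>rtrace (X o\<^sub>L \<rho>)\<bar>) ?FB"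
    unfolding has_sum_def by (intro tendsto_rabs) simp
  moreover have "((\<lambda>F. norm X * rtrace \<rho> + norm X * suminf (r F)) \<longlongrightarrow> norm X * rtrace \<rho> + norm X * 0) ?FB"
    by (intro tendsto_intros lim_r)
  moreover have "\<forall>\<^sub>F F in ?FB. \<bar>\<Sum>e\<in>F. inner e (X (\<rho> e))\<bar> \<le> norm X * rtrace \<rho> + norm X * suminf (r F)"
    using ev by (rule eventually_mono) (use err in blast)
  ultimately have "\<bar>rtrace (X o\<^sub>L \<rho>)\<bar> \<le> norm X * rtrace \<rho> + norm X * 0"
    using tendsto_le[OF finite_subsets_at_top_neq_bot] by blast
  then show ?thesis by simp
qed

text \<open>Over the reals each complex direction counts twice, which is also the origin of the
  halving in \<open>ctrace\<close>.\<close>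

lemma rtrace_density:
  assumes "density_op J \<rho>"
  shows "rtrace \<rho> = 2"
  using assms unfolding density_op_def ctrace_def by (auto simp: complex_eq_iff)

lemma rtrace_compose_density_bound:
  fixes X :: "'h::{real_inner,complete_space} \<Rightarrow>\<^sub>L 'h"
  assumes "density_op J \<rho>"
  shows "\<bar>rtrace (X o\<^sub>L \<rho>)\<bar> \<le> 2 * norm X"
  using assms rtrace_compose_positive_bound[of \<rho> X] rtrace_density[OF assms]
  unfolding density_op_def by (simp add: mult.commute)

section \<open>Derivatives of traces along a path differentiable in trace norm\<close>

lemma has_real_derivative_rtrace_compose_const:
  fixes A D :: "'h::{real_inner,complete_space} \<Rightarrow>\<^sub>L 'h"
  assumes tc: "\<And>t. t \<in> S \<Longrightarrow> trace_class (\<rho> t)" "trace_class D"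
    and D: "has_trace_norm_derivative \<rho> D s S" and s: "s \<in> S"
  shows "((\<lambda>t. rtrace (A o\<^sub>L \<rho> t)) has_real_derivative rtrace (A o\<^sub>L D)) (at s within S)"
  unfolding has_field_derivative_iff
proof (rule LIM_zero_cancel, rule Lim_null_comparison)
  let ?E = "\<lambda>t. (1 / (t - s)) *\<^sub>R (\<rho> t - \<rho> s) - D"
  show "((\<lambda>t. norm A * trace_norm (?E t)) \<longlongrightarrow> 0) (at s within S)"
    using tendsto_mult_right_zero[OF D[unfolded has_trace_norm_derivative_def]] .
  show "\<forall>\<^sub>F t in at s within S. norm ((rtrace (A o\<^sub>L \<rho> t) - rtrace (A o\<^sub>L \<rho> s)) / (t - s) - rtrace (A o\<^sub>L D))
      \<le> norm A * trace_norm (?E t)"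
    unfolding eventually_at_filter
  proof (intro always_eventually allI impI)
    fix t assume t: "t \<in> S"
    have "A o\<^sub>L ?E t = (1 / (t - s)) *\<^sub>R ((A o\<^sub>L \<rho> t) - (A o\<^sub>L \<rho> s)) - (A o\<^sub>L D)"
      by (rule blinfun_eqI) (simp add: blinfun.add_left blinfun.diff_left blinfun.diff_right blinfun.scaleR_left blinfun.scaleR_right)
    then have "rtrace (A o\<^sub>L ?E t) = (rtrace (A o\<^sub>L \<rho> t) - rtrace (A o\<^sub>L \<rho> s)) / (t - s) - rtrace (A o\<^sub>L D)"
      using tc t s by (simp add: rtrace_diff rtrace_scaleR trace_class_diff trace_class_scaleR trace_class_compose)
    moreover have "trace_class (?E t)"
      using tc t s by (intro trace_class_diff trace_class_scaleR)
    ultimately show "norm ((rtrace (A o\<^sub>L \<rho> t) - rtrace (A o\<^sub>L \<rho> s)) / (t - s) - rtrace (A o\<^sub>L D))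
      \<le> norm A * trace_norm (?E t)"
      using rtrace_compose_le_trace_norm[of "?E t" A] by simp
  qed
qed

text \<open>A product rule in which \<open>A\<close> is differentiable in operator norm and \<rho>
  in trace norm. The increment is split into the linearisation error of \<open>A\<close> against
  \<open>\<rho> t\<close>, the term \<open>(t - s) A'\<close> against \<open>\<rho> t\<close>, and
  \<open>A s\<close> against the increment of \<rho>. The uniform bound \<open>K\<close> controls
  the first term, so continuity of \<rho> in trace norm is not invoked.\<close>

lemma has_real_derivative_rtrace_compose:
  fixes A :: "real \<Rightarrow> 'h::{real_inner,complete_space} \<Rightarrow>\<^sub>L 'h"
  assumes tc: "\<And>t. t \<in> S \<Longrightarrow> trace_class (\<rho> t)" "trace_class D"
    and bd: "\<And>t X. t \<in> S \<Longrightarrow> \<bar>rtrace (X o\<^sub>L \<rho> t)\<bar> \<le> K * norm X"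
    and D: "has_trace_norm_derivative \<rho> D s S" and s: "s \<in> S"
    and A: "(A has_vector_derivative A') (at s within S)"
  shows "((\<lambda>t. rtrace (A t o\<^sub>L \<rho> t)) has_real_derivative rtrace (A' o\<^sub>L \<rho> s) + rtrace (A s o\<^sub>L D)) (at s within S)"
proof -
  let ?E = "\<lambda>t. A t - A s - (t - s) *\<^sub>R A'"
  let ?q = "\<lambda>t. rtrace (?E t o\<^sub>L \<rho> t) / (t - s)"
  note const = has_real_derivative_rtrace_compose_const[OF tc D s]
  have "((\<lambda>t. norm (?E t) / norm (t - s)) \<longlongrightarrow> 0) (at s within S)"
    using A unfolding has_vector_derivative_def has_derivative_iff_norm by blast
  from tendsto_mult_right_zero[OF this, of K]
  have lim_q: "(?q \<longlongrightarrow> 0) (at s within S)"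
  proof (rule Lim_null_comparison[rotated])
    show "\<forall>\<^sub>F t in at s within S. norm (?q t) \<le> K * (norm (?E t) / norm (t - s))"
      unfolding eventually_at_filter
    proof (intro always_eventually allI impI)
      fix t assume "t \<in> S"
      show "norm (?q t) \<le> K * (norm (?E t) / norm (t - s))"
        using divide_right_mono[OF bd[OF \<open>t \<in> S\<close>, of "?E t"], of "\<bar>t - s\<bar>"] by simp
    qed
  qed
  have "((\<lambda>t. rtrace (A' o\<^sub>L \<rho> t)) \<longlongrightarrow> rtrace (A' o\<^sub>L \<rho> s)) (at s within S)"
    using DERIV_continuous[OF const] unfolding continuous_within .
  moreover have "((\<lambda>t. (rtrace (A s o\<^sub>L \<rho> t) - rtrace (A s o\<^sub>L \<rho> s)) / (t - s)) \<longlongrightarrow> rtrace (A s o\<^sub>L D)) (at s within S)"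
    using const unfolding has_field_derivative_iff .
  ultimately have "((\<lambda>t. ?q t + (rtrace (A' o\<^sub>L \<rho> t) + (rtrace (A s o\<^sub>L \<rho> t) - rtrace (A s o\<^sub>L \<rho> s)) / (t - s)))
     \<longlongrightarrow> 0 + (rtrace (A' o\<^sub>L \<rho> s) + rtrace (A s o\<^sub>L D))) (at s within S)"
    by (intro tendsto_add lim_q)
  moreover have "\<forall>\<^sub>F t in at s within S. ?q t + (rtrace (A' o\<^sub>L \<rho> t) + (rtrace (A s o\<^sub>L \<rho> t) - rtrace (A s o\<^sub>L \<rho> s)) / (t - s))
      = (rtrace (A t o\<^sub>L \<rho> t) - rtrace (A s o\<^sub>L \<rho> s)) / (t - s)"
    unfolding eventually_at_filter
  proof (intro always_eventually allI impI)
    fix t assume t: "t \<noteq> s" "t \<in> S"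
    have "?E t o\<^sub>L \<rho> t = ((A t o\<^sub>L \<rho> t) - (A s o\<^sub>L \<rho> t)) - (t - s) *\<^sub>R (A' o\<^sub>L \<rho> t)"
      by (rule blinfun_eqI) (simp add: blinfun.add_left blinfun.diff_left blinfun.diff_right blinfun.scaleR_left blinfun.scaleR_right)
    then have eq: "rtrace (?E t o\<^sub>L \<rho> t) = rtrace (A t o\<^sub>L \<rho> t) - rtrace (A s o\<^sub>L \<rho> t) - (t - s) * rtrace (A' o\<^sub>L \<rho> t)"
      using tc t by (simp add: rtrace_diff rtrace_scaleR trace_class_diff trace_class_scaleR trace_class_compose)
    have alg: "(a - b - h * c) / h + (c + (b - d) / h) = (a - d) / h" if "h \<noteq> 0" for a b c d h :: real
      using that by (simp add: field_simps)
    show "?q t + (rtrace (A' o\<^sub>L \<rho> t) + (rtrace (A s o\<^sub>L \<rho> t) - rtrace (A s o\<^sub>L \<rho> s)) / (t - s))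
      = (rtrace (A t o\<^sub>L \<rho> t) - rtrace (A s o\<^sub>L \<rho> s)) / (t - s)"
      unfolding eq using t by (intro alg) simp
  qed
  ultimately show ?thesis
    unfolding has_field_derivative_iff by (simp add: tendsto_cong)
qed

section \<open>Absolutely continuous functions\<close>

text \<open>Re-indexing by arbitrary finite sets allows the intervals of a division, or the pairs of
  a tagged division, to serve as their own indices.\<close>

lemma abs_continuous_onD:
  fixes a b :: "'i \<Rightarrow> real"
  assumes "abs_continuous_on S f" "\<epsilon> > 0"
  obtains \<delta> where "\<delta> > 0"
    "\<And>(I :: 'i set) a b. \<lbrakk>finite I; \<And>i. i \<in> I \<Longrightarrow> a i \<le> b i \<and> {a i..b i} \<subseteq> S;
        \<And>i j. i \<in> I \<Longrightarrow> j \<in> I \<Longrightarrow> i \<noteq> j \<Longrightarrow> {a i<..<b i} \<inter> {a j<..<b j} = {};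
        (\<Sum>i\<in>I. b i - a i) < \<delta>\<rbrakk> \<Longrightarrow> (\<Sum>i\<in>I. \<bar>f (b i) - f (a i)\<bar>) < \<epsilon>"
proof -
  obtain \<delta> where "\<delta> > 0" and \<delta>: "\<And>(n::nat) (a::nat\<Rightarrow>real) b.
     (\<forall>i<n. a i \<le> b i \<and> {a i..b i} \<subseteq> S) \<and>
     (\<forall>i<n. \<forall>j<n. i \<noteq> j \<longrightarrow> {a i<..<b i} \<inter> {a j<..<b j} = {}) \<and>
     (\<Sum>i<n. b i - a i) < \<delta> \<longrightarrow> (\<Sum>i<n. \<bar>f (b i) - f (a i)\<bar>) < \<epsilon>"
    using assms(1)[unfolded abs_continuous_on_def, rule_format, OF assms(2)] by (elim exE conjE) iprover
  show thesis
  proof (rule that[OF \<open>\<delta> > 0\<close>])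
    fix I :: "'i set" and a b
    assume I: "finite I" "\<And>i. i \<in> I \<Longrightarrow> a i \<le> b i \<and> {a i..b i} \<subseteq> S"
      and disj: "\<And>i j. i \<in> I \<Longrightarrow> j \<in> I \<Longrightarrow> i \<noteq> j \<Longrightarrow> {a i<..<b i} \<inter> {a j<..<b j} = {}"
      and small: "(\<Sum>i\<in>I. b i - a i) < \<delta>"
    obtain h where h: "bij_betw h {..<card I} I"
      using ex_bij_betw_nat_finite[OF I(1)] atLeast0LessThan by metis
    have sum_h: "(\<Sum>i<card I. g (h i)) = sum g I" for g :: "'i \<Rightarrow> real"
      by (rule sum.reindex_bij_betw[OF h])
    have hI: "h i \<in> I" if "i < card I" for i
      using bij_betwE[OF h] that by auto
    have hinj: "h i \<noteq> h j" if "i < card I" "j < card I" "i \<noteq> j" for i j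
      using bij_betw_imp_inj_on[OF h] that by (auto dest: inj_onD)
    have "(\<Sum>i<card I. \<bar>f (b (h i)) - f (a (h i))\<bar>) < \<epsilon>"
      by (rule \<delta>[rule_format, of _ "\<lambda>i. a (h i)" "\<lambda>i. b (h i)"])
        (use I(2) disj hI hinj small sum_h[of "\<lambda>i. b i - a i"] in auto)
    then show "(\<Sum>i\<in>I. \<bar>f (b i) - f (a i)\<bar>) < \<epsilon>"
      using sum_h[of "\<lambda>i. \<bar>f (b i) - f (a i)\<bar>"] by simp
  qed
qed

section \<open>Vitali coverings and differentiability almost everywhere\<close>

lemma division_of_interval:
  fixes D :: "real set set"
  assumes "D division_of S" "K \<in> D"
  shows "Inf K \<le> Sup K" "K = {Inf K..Sup K}" "measure lborel K = Sup K - Inf K"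
    "interior K = {Inf K<..<Sup K}"
proof -
  obtain u v where "K = {u..v}" "u \<le> v"
    using division_ofD(3,4)[OF assms] by fastforce
  then show "Inf K \<le> Sup K" "K = {Inf K..Sup K}" "measure lborel K = Sup K - Inf K"
    "interior K = {Inf K<..<Sup K}" by auto
qed

lemma abs_continuous_on_divisionD:
  assumes "abs_continuous_on S f" "\<epsilon> > 0"
  obtains \<delta> where "\<delta> > 0"
    "\<And>D. \<lbrakk>D division_of (\<Union>D); \<Union>D \<subseteq> S; sum (measure lborel) D < \<delta>\<rbrakk>
        \<Longrightarrow> (\<Sum>K\<in>D. \<bar>f (Sup K) - f (Inf K)\<bar>) < \<epsilon>"
proof -
  obtain \<delta> where "\<delta> > 0"
    and \<delta>: "\<And>(I :: real set set) a b. \<lbrakk>finite I; \<And>i. i \<in> I \<Longrightarrow> a i \<le> b i \<and> {a i..b i} \<subseteq> S;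
        \<And>i j. i \<in> I \<Longrightarrow> j \<in> I \<Longrightarrow> i \<noteq> j \<Longrightarrow> {a i<..<b i} \<inter> {a j<..<b j} = {};
        (\<Sum>i\<in>I. b i - a i) < \<delta>\<rbrakk> \<Longrightarrow> (\<Sum>i\<in>I. \<bar>f (b i) - f (a i)\<bar>) < \<epsilon>"
    by (rule abs_continuous_onD[OF assms, where 'i="real set"]) iprover
  show thesis
  proof (rule that[OF \<open>\<delta> > 0\<close>])
    fix D assume D: "D division_of (\<Union>D)" "\<Union>D \<subseteq> S" "sum (measure lborel) D < \<delta>"
    note iv = division_of_interval[OF D(1)]
    show "(\<Sum>K\<in>D. \<bar>f (Sup K) - f (Inf K)\<bar>) < \<epsilon>"
    proof (rule \<delta>)
      show "Inf K \<le> Sup K \<and> {Inf K..Sup K} \<subseteq> S" if "K \<in> D" for K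
        using iv[OF that] D(2) that by blast
      show "{Inf K<..<Sup K} \<inter> {Inf L<..<Sup L} = {}" if "K \<in> D" "L \<in> D" "K \<noteq> L" for K L
        using division_ofD(5)[OF D(1) that] iv(4) that by simp
      have "(\<Sum>K\<in>D. Sup K - Inf K) = sum (measure lborel) D"
        by (rule sum.cong) (simp_all add: iv(3))
      then show "(\<Sum>K\<in>D. Sup K - Inf K) < \<delta>" using D(3) by simp
    qed (use D(1) in blast)
  qed
qed

text \<open>Telescoping, reduced to tagged divisions by tagging every interval with its left
  end.\<close>

lemma sum_increments_division:
  fixes f :: "real \<Rightarrow> real"
  assumes "D division_of {a..b}" "a \<le> b"
  shows "(\<Sum>K\<in>D. f (Sup K) - f (Inf K)) = f b - f a"
proof -
  let ?p = "(\<lambda>K. (Inf K, K)) ` D"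
  note iv = division_of_interval[OF assms(1)]
  have "?p tagged_division_of {a..b}"
  proof (rule tagged_division_ofI)
    fix x K assume "(x, K) \<in> ?p"
    then have K: "K \<in> D" "x = Inf K" by auto
    show "x \<in> K" using iv(1,2)[OF K(1)] K(2) by (metis atLeastAtMost_iff order_refl)
    show "K \<subseteq> {a..b}" "\<exists>a b. K = cbox a b" using division_ofD(2,4)[OF assms(1) K(1)] by auto
  next
    have "{K. \<exists>x. (x, K) \<in> ?p} = D" by auto
    then show "\<Union>{K. \<exists>x. (x, K) \<in> ?p} = {a..b}" using division_ofD(6)[OF assms(1)] by simp
  qed (use assms(1) in \<open>auto dest: division_ofD(5)[OF assms(1)] division_ofD(1)\<close>)
  from additive_tagged_division_1[OF assms(2) this, of f]
  show ?thesis by (subst (asm) sum.reindex) (auto simp: inj_on_def)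
qed

text \<open>The set \<open>E\<close> need not be measurable; the last but one hypothesis says that its outer measure is
  at least \<open>m\<close>.\<close>

lemma finite_Vitali_selection:
  fixes Q :: "real \<Rightarrow> real \<Rightarrow> bool"
  assumes U: "open U" "U \<in> lmeasurable" "E \<subseteq> U"
    and fine: "\<And>x d. x \<in> E \<Longrightarrow> d > 0 \<Longrightarrow> \<exists>u v. u < v \<and> x \<in> {u..v} \<and> v - u < d \<and> Q u v"
    and outer: "\<And>T. T \<in> lmeasurable \<Longrightarrow> E \<subseteq> T \<Longrightarrow> m \<le> measure lebesgue T"
    and \<epsilon>: "\<epsilon> > 0"
  obtains p where "p division_of (\<Union>p)" "\<Union>p \<subseteq> U"
    "\<forall>K\<in>p. \<exists>u v. u < v \<and> K = {u..v} \<and> Q u v"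
    "m - \<epsilon> < sum (measure lborel) p" "measure lebesgue (\<Union>p) = sum (measure lborel) p"
proof -
  \<comment> \<open>The covering theorem speaks of balls, so intervals are coded by midpoint and
    half-length.\<close>
  define I where "I = {(c::real, r). r > 0 \<and> cball c r \<subseteq> U \<and> Q (c - r) (c + r)}"
  have pos: "0 < snd i" if "i \<in> I" for i using that by (auto simp: I_def)
  have cover: "\<exists>i. i \<in> I \<and> x \<in> cball (fst i) (snd i) \<and> snd i < d" if x: "x \<in> E" and d: "d > 0" for x d
  proof -
    obtain e where e: "e > 0" "ball x e \<subseteq> U" using U x openE by blast
    obtain u v where uv: "u < v" "x \<in> {u..v}" "v - u < min d e" "Q u v"
      using fine[OF x, of "min d e"] d e by auto
    define c r where "c = (u + v) / 2" and "r = (v - u) / 2"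
    have cr: "c - r = u" "c + r = v" unfolding c_def r_def by (auto simp: field_simps)
    have cb: "cball c r = {u..v}" using cr by (simp add: cball_eq_atLeastAtMost)
    have "{u..v} \<subseteq> ball x e" using uv by (auto simp: dist_real_def)
    then have "(c, r) \<in> I" using uv e cr cb unfolding I_def r_def by auto
    then show ?thesis using uv cb unfolding r_def by (intro exI[of _ "(c, r)"]) (auto simp: r_def)
  qed
  obtain C where C: "countable C" "C \<subseteq> I"
    and disj: "pairwise (\<lambda>i j. disjnt (cball (fst i) (snd i)) (cball (fst j) (snd j))) C"
    and neg: "negligible (E - (\<Union>i\<in>C. cball (fst i) (snd i)))"
    by (rule Vitali_covering_theorem_cballs[of I snd E fst, OF pos cover])
  define D where "D = (\<lambda>i. cball (fst i) (snd i)) ` C"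
  have D_ex: "\<exists>u v. u < v \<and> K = {u..v} \<and> Q u v" if KD: "K \<in> D" for K
  proof -
    obtain i where "i \<in> I" "K = cball (fst i) (snd i)" using KD C(2) unfolding D_def by blast
    then show ?thesis
      unfolding I_def by (intro exI[of _ "fst i - snd i"] exI[of _ "fst i + snd i"])
        (auto simp: cball_eq_atLeastAtMost)
  qed
  have IU: "cball (fst i) (snd i) \<subseteq> U" if "i \<in> I" for i using that unfolding I_def by auto
  have DU: "K \<subseteq> U" if "K \<in> D" for K using that C(2) IU unfolding D_def by blast
  have Dm: "K \<in> lmeasurable" if "K \<in> D" for K using that unfolding D_def by auto
  have Ddisj: "disjnt K L" if "K \<in> D" "L \<in> D" "K \<noteq> L" for K L
    using that disj unfolding D_def pairwise_def by auto
  have cD: "countable D" unfolding D_def using C by simp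
  have sets: "D' \<subseteq> D \<Longrightarrow> \<Union>D' \<in> sets lebesgue" for D'
    using cD Dm by (intro sets.countable_Union) (auto intro: countable_subset fmeasurableD)
  have UD: "D' \<subseteq> D \<Longrightarrow> \<Union>D' \<in> lmeasurable" for D'
    using DU by (intro fmeasurableI2[OF U(2) _ sets]) auto
  have "measure lebesgue (\<Union>D') \<le> measure lebesgue U" if "D' \<subseteq> D" for D'
    using UD[OF that] U DU that by (intro measure_mono_fmeasurable) auto
  then obtain p where p: "p \<subseteq> D" "finite p" "measure lebesgue (\<Union>D) - \<epsilon> < measure lebesgue (\<Union>p)"
    using measure_countable_Union_approachable[OF cD \<epsilon> Dm] by metis
  have neg': "negligible (E - \<Union>D)" using neg unfolding D_def .
  have UDm: "\<Union>D \<in> lmeasurable" using UD by blast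
  have "m \<le> measure lebesgue (\<Union>D \<union> (E - \<Union>D))"
    by (rule outer[OF fmeasurable.Un[OF UDm negligible_imp_measurable[OF neg']]]) blast
  also have "\<dots> = measure lebesgue (\<Union>D)"
    using neg' UDm unfolding negligible_iff_null_sets by (intro measure_Un_null_set) auto
  finally have mD: "m \<le> measure lebesgue (\<Union>D)" .
  have "measure lebesgue (\<Union>p) = (\<Sum>K\<in>p. measure lebesgue K)"
  proof (rule measure_Union')
    show "pairwise disjnt p" using Ddisj p(1) unfolding pairwise_def by blast
  qed (use p Dm in auto)
  also have "\<dots> = sum (measure lborel) p"
  proof (rule sum.cong[OF refl])
    fix K assume "K \<in> p"
    then obtain u v where "u < v" "K = {u..v}" using D_ex p(1) by blast
    then show "measure lebesgue K = measure lborel K" by simp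
  qed
  finally have msum: "measure lebesgue (\<Union>p) = sum (measure lborel) p" .
  have "p division_of (\<Union>p)"
  proof (rule division_ofI)
    show "K \<noteq> {}" "\<exists>a b. K = cbox a b" if "K \<in> p" for K
      using D_ex[of K] p that by force+
    show "interior K \<inter> interior L = {}" if "K \<in> p" "L \<in> p" "K \<noteq> L" for K L
      using Ddisj[of K L] that p interior_subset unfolding disjnt_def by blast
  qed (use p in auto)
  moreover have "\<Union>p \<subseteq> U" using p DU by blast
  moreover have "\<forall>K\<in>p. \<exists>u v. u < v \<and> K = {u..v} \<and> Q u v" using D_ex p(1) by blast
  moreover have "m - \<epsilon> < sum (measure lborel) p" using p(3) mD msum by linarith
  ultimately show thesis using msum by (rule that)
qed

text \<open>The witness is the Lebesgue outer measure of \<open>E\<close>, written as an infimum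
  over measurable supersets. Failure of negligibility is its positivity, and outer regularity
  provides the open sets.\<close>

lemma outer_measure_approx:
  fixes E :: "real set"
  assumes "\<not> negligible E" "E \<subseteq> U" "open U" "U \<in> lmeasurable"
  obtains m where "m > 0" "\<And>T. T \<in> lmeasurable \<Longrightarrow> E \<subseteq> T \<Longrightarrow> m \<le> measure lebesgue T"
    "\<And>\<epsilon>. \<epsilon> > 0 \<Longrightarrow> \<exists>V. open V \<and> V \<in> lmeasurable \<and> E \<subseteq> V \<and> V \<subseteq> U \<and> measure lebesgue V < m + \<epsilon>"
proof -
  define M where "M = measure lebesgue ` {T \<in> lmeasurable. E \<subseteq> T}"
  have M: "M \<noteq> {}" "bdd_below M"
    using assms unfolding M_def by (auto intro!: bdd_belowI2[of _ 0])
  obtain e where e: "e > 0" "\<And>T. T \<in> lmeasurable \<Longrightarrow> E \<subseteq> T \<Longrightarrow> e \<le> measure lebesgue T"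
    using assms(1) unfolding negligible_outer by (meson not_le)
  show thesis
  proof (rule that[of "Inf M"])
    have "e \<le> Inf M" using M(1) e(2) unfolding M_def by (intro cInf_greatest) auto
    then show "Inf M > 0" using e by simp
    show "Inf M \<le> measure lebesgue T" if "T \<in> lmeasurable" "E \<subseteq> T" for T
      using that M(2) unfolding M_def by (intro cInf_lower) auto
    fix \<epsilon> :: real assume \<epsilon>: "\<epsilon> > 0"
    then have "\<exists>x\<in>M. x < Inf M + \<epsilon> / 2" using M cInf_less_iff[of M "Inf M + \<epsilon> / 2"] by simp
    then obtain T where T: "T \<in> lmeasurable" "E \<subseteq> T" "measure lebesgue T < Inf M + \<epsilon> / 2"
      unfolding M_def by blast
    obtain V where V: "open V" "T \<subseteq> V" "V - T \<in> lmeasurable" "emeasure lebesgue (V - T) < ennreal (\<epsilon> / 2)"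
      using sets_lebesgue_outer_open[of T "\<epsilon> / 2"] T \<epsilon> by auto
    have "V = T \<union> (V - T)" using V by blast
    then have Vm: "V \<in> lmeasurable" using T V fmeasurable.Un by metis
    have "measure lebesgue (V - T) < \<epsilon> / 2"
      using V(3,4) \<epsilon> by (simp add: emeasure_eq_measure2 ennreal_less_iff)
    moreover have "measure lebesgue V \<le> measure lebesgue T + measure lebesgue (V - T)"
      using measure_Un_le[of T lebesgue "V - T"] T V \<open>V = T \<union> (V - T)\<close> by (metis fmeasurableD)
    ultimately have "measure lebesgue V < Inf M + \<epsilon>" using T(3) by linarith
    moreover have "measure lebesgue (V \<inter> U) \<le> measure lebesgue V"
      using Vm assms by (intro measure_mono_fmeasurable) auto
    ultimately show "\<exists>V. open V \<and> V \<in> lmeasurable \<and> E \<subseteq> V \<and> V \<subseteq> U \<and> measure lebesgue V < Inf M + \<epsilon>"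
      using V T Vm assms by (intro exI[of _ "V \<inter> U"]) auto
  qed
qed

text \<open>Passing to interiors costs no measure and supplies the open set in which a second Vitali
  selection can be made.\<close>

lemma measure_Union_interior_division:
  fixes p :: "real set set"
  assumes "p division_of (\<Union>p)"
  shows "open (\<Union>K\<in>p. interior K)" "(\<Union>K\<in>p. interior K) \<in> lmeasurable"
    "measure lebesgue (\<Union>K\<in>p. interior K) = sum (measure lborel) p"
proof -
  note iv = division_of_interval[OF assms]
  show "open (\<Union>K\<in>p. interior K)" by auto
  have m: "interior K \<in> lmeasurable" if "K \<in> p" for K using iv(4)[OF that] by simp
  then show "(\<Union>K\<in>p. interior K) \<in> lmeasurable"
    using assms by (intro fmeasurable.finite_UN) auto
  have "measure lebesgue (\<Union>K\<in>p. interior K) = (\<Sum>K\<in>p. measure lebesgue (interior K))"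
    using assms m by (intro measure_UNION') (auto simp: pairwise_def disjnt_def)
  also have "\<dots> = sum (measure lborel) p"
    using iv by (intro sum.cong refl) simp
  finally show "measure lebesgue (\<Union>K\<in>p. interior K) = sum (measure lborel) p" .
qed

text \<open>Selecting first intervals of slope at most \<open>\<mu> - c\<close> and then, inside their union, intervals of
  slope at least \<open>\<mu> + c\<close> exhausts almost the same measure; by absolute continuity the leftover
  contributes little, so both families would have nearly the same total increment.\<close>

lemma negligible_two_slopes:
  fixes f :: "real \<Rightarrow> real"
  assumes ac: "abs_continuous_on {a..b} f" and E: "E \<subseteq> {a<..<b}" and c: "c > 0"
    and low: "\<And>x d. x \<in> E \<Longrightarrow> d > 0 \<Longrightarrow>
      \<exists>u v. u < v \<and> x \<in> {u..v} \<and> v - u < d \<and> f v - f u \<le> (\<mu> - c) * (v - u)"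
    and high: "\<And>x d. x \<in> E \<Longrightarrow> d > 0 \<Longrightarrow>
      \<exists>u v. u < v \<and> x \<in> {u..v} \<and> v - u < d \<and> f v - f u \<ge> (\<mu> + c) * (v - u)"
  shows "negligible E"
proof (rule ccontr)
  assume "\<not> negligible E"
  then obtain m where m: "m > 0" and outer: "\<And>T. T \<in> lmeasurable \<Longrightarrow> E \<subseteq> T \<Longrightarrow> m \<le> measure lebesgue T"
    and approx: "\<And>\<epsilon>. \<epsilon> > 0 \<Longrightarrow> \<exists>V. open V \<and> V \<in> lmeasurable \<and> E \<subseteq> V \<and> V \<subseteq> {a<..<b} \<and> measure lebesgue V < m + \<epsilon>"
    using outer_measure_approx[of E "{a<..<b}"] E by auto
  have ab: "a \<le> b" using \<open>\<not> negligible E\<close> E by force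
  let ?\<Delta> = "\<lambda>K. f (Sup K) - f (Inf K)"
  have cm: "c * m / 4 > 0" using c m by simp
  obtain \<delta> where \<delta>: "\<delta> > 0" "\<And>D. \<lbrakk>D division_of (\<Union>D); \<Union>D \<subseteq> {a..b}; sum (measure lborel) D < \<delta>\<rbrakk>
        \<Longrightarrow> (\<Sum>K\<in>D. \<bar>?\<Delta> K\<bar>) < c * m / 4"
    by (rule abs_continuous_on_divisionD[OF ac cm]) iprover
  \<comment> \<open>The three bounds serve, in order, to keep the uncovered length
    \<open>2 * \<epsilon>\<close> within \<delta>, to make the selected measure exceed
    \<open>m / 2\<close>, and to keep \<open>\<bar>\<mu>\<bar> * (2 * \<epsilon>)\<close> within
    \<open>c * m / 4\<close>.\<close>
  define \<epsilon> where "\<epsilon> = Min {\<delta> / 2, m / 2, c * m / (8 * (\<bar>\<mu>\<bar> + 1))}"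
  have \<epsilon>: "\<epsilon> > 0" "\<epsilon> \<le> \<delta> / 2" "\<epsilon> \<le> m / 2" "\<epsilon> \<le> c * m / (8 * (\<bar>\<mu>\<bar> + 1))"
  proof -
    show "\<epsilon> > 0" unfolding \<epsilon>_def using \<delta>(1) m c by (auto intro!: divide_pos_pos)
    show "\<epsilon> \<le> \<delta> / 2" unfolding \<epsilon>_def by (rule Min_le) simp_all
    show "\<epsilon> \<le> m / 2" unfolding \<epsilon>_def by (rule Min_le) simp_all
    show "\<epsilon> \<le> c * m / (8 * (\<bar>\<mu>\<bar> + 1))" unfolding \<epsilon>_def by (rule Min_le) simp_all
  qed
  obtain V where V: "open V" "V \<in> lmeasurable" "E \<subseteq> V" "V \<subseteq> {a<..<b}" "measure lebesgue V < m + \<epsilon>"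
    using approx[OF \<epsilon>(1)] by blast
  obtain p where p: "p division_of (\<Union>p)" "\<Union>p \<subseteq> V"
    and p_slope: "\<forall>K\<in>p. \<exists>u v. u < v \<and> K = {u..v} \<and> f v - f u \<le> (\<mu> - c) * (v - u)"
    and p_size: "m - \<epsilon> < sum (measure lborel) p" and "measure lebesgue (\<Union>p) = sum (measure lborel) p"
    by (rule finite_Vitali_selection[OF V(1,2,3) low outer \<epsilon>(1)])
  define W where "W = (\<Union>K\<in>p. interior K)"
  have W: "open W" "W \<in> lmeasurable" "measure lebesgue W = sum (measure lborel) p" "W \<subseteq> V"
    using measure_Union_interior_division[OF p(1)] p(2) interior_subset unfolding W_def by blast+
  \<comment> \<open>Adding \<open>V - W\<close> to a cover of \<open>E \<inter> W\<close> gives a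
    cover of \<open>E\<close>, so restricting to \<open>W\<close> lowers the outer measure by at
    most the measure of \<open>V - W\<close>.\<close>
  have outer_W: "m - (measure lebesgue V - measure lebesgue W) \<le> measure lebesgue T"
    if "T \<in> lmeasurable" "E \<inter> W \<subseteq> T" for T
  proof -
    have "m \<le> measure lebesgue (T \<union> (V - W))"
      using that V W by (intro outer) (auto intro: fmeasurable.Un fmeasurable.Diff)
    also have "\<dots> \<le> measure lebesgue T + measure lebesgue (V - W)"
      using that V W by (intro measure_Un_le) auto
    also have "measure lebesgue (V - W) = measure lebesgue V - measure lebesgue W"
      using V W by (intro measurable_measure_Diff) auto
    finally show ?thesis by simp
  qed
  \<comment> \<open>Recording that each interval lies inside one interval of \<open>p\<close> later
    shows that the selected family does not overlap the gaps left by \<open>p\<close>.\<close>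
  have high_W: "\<exists>u v. u < v \<and> x \<in> {u..v} \<and> v - u < d \<and> (f v - f u \<ge> (\<mu> + c) * (v - u) \<and> (\<exists>K\<in>p. {u..v} \<subseteq> interior K))"
    if x: "x \<in> E \<inter> W" and d: "d > 0" for x d
  proof -
    obtain K where K: "K \<in> p" "x \<in> interior K" using x unfolding W_def by blast
    obtain e where e: "e > 0" "ball x e \<subseteq> interior K" using openE[OF open_interior K(2)] by blast
    obtain u v where uv: "u < v" "x \<in> {u..v}" "v - u < min d e" "f v - f u \<ge> (\<mu> + c) * (v - u)"
      using high[of x "min d e"] x d e by auto
    have "{u..v} \<subseteq> ball x e" using uv by (auto simp: dist_real_def)
    then show ?thesis using uv e K by (intro exI[of _ u] exI[of _ v]) auto
  qed
  obtain r where r: "r division_of (\<Union>r)" "\<Union>r \<subseteq> W"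
    and r_slope: "\<forall>K\<in>r. \<exists>u v. u < v \<and> K = {u..v} \<and> (f v - f u \<ge> (\<mu> + c) * (v - u) \<and> (\<exists>K\<in>p. {u..v} \<subseteq> interior K))"
    and r_size: "m - (measure lebesgue V - measure lebesgue W) - \<epsilon> < sum (measure lborel) r"
    and "measure lebesgue (\<Union>r) = sum (measure lborel) r"
    by (rule finite_Vitali_selection[OF W(1,2) Int_lower2 high_W outer_W \<epsilon>(1)])
  have "\<Union>p \<subseteq> cbox a b" using p(2) V(4) by force
  then obtain q where q: "p \<subseteq> q" "q division_of cbox a b"
    using partial_division_extend_interval[OF p(1)] by blast
  \<comment> \<open>The gaps of \<open>p\<close> in \<open>{a..b}\<close>. They belong to both
    divisions \<open>q\<close> and \<open>s\<close>, so comparing the two telescoping sums cancels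
    them and leaves the increments of \<open>p\<close> against those of \<open>r\<close> and the
    leftover \<open>R\<close>.\<close>
  define G where "G = q - p"
  have fin: "finite q" "finite p" "finite r" "finite G"
    using q p(1) r(1) unfolding G_def by auto
  have Gr: "interior K \<inter> interior L = {}" "K \<noteq> L" if KL: "K \<in> r" "L \<in> G" for K L
  proof -
    obtain M where M: "M \<in> p" "K \<subseteq> interior M" using bspec[OF r_slope KL(1)] by blast
    have "interior M \<inter> interior L = {}"
      using division_ofD(5)[OF q(2), of M L] M q(1) KL(2) unfolding G_def by blast
    then show d: "interior K \<inter> interior L = {}" using M interior_subset by blast
    obtain u v where "u < v" "K = {u..v}" using bspec[OF r_slope KL(1)] by blast
    then have "interior K \<noteq> {}" by simp
    then show "K \<noteq> L" using d by auto
  qed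
  have rG1: "(r \<union> G) division_of (\<Union>(r \<union> G))"
  proof (rule division_ofI)
    show "K \<noteq> {}" "\<exists>a b. K = cbox a b" if "K \<in> r \<union> G" for K
      using that division_ofD(3,4)[OF r(1)] division_ofD(3,4)[OF q(2)] unfolding G_def by blast+
    show "interior K \<inter> interior L = {}" if "K \<in> r \<union> G" "L \<in> r \<union> G" "K \<noteq> L" for K L
      using that Gr division_ofD(5)[OF r(1)] division_ofD(5)[OF q(2)] unfolding G_def by blast
  qed (use fin in auto)
  have rG2: "\<Union>(r \<union> G) \<subseteq> cbox a b"
    using r(2) W(4) V(4) division_ofD(6)[OF q(2)] unfolding G_def by force
  obtain s where s: "r \<union> G \<subseteq> s" "s division_of cbox a b"
    by (rule partial_division_extend_interval[OF rG1 rG2])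
  define R where "R = s - (r \<union> G)"
  have split: "sum g q = sum g p + sum g G" "sum g s = sum g r + sum g G + sum g R" for g :: "real set \<Rightarrow> real"
  proof -
    show "sum g q = sum g p + sum g G"
      unfolding G_def using fin q(1) by (metis add.commute sum.subset_diff)
    have "finite s" using s(2) by blast
    then have "sum g s = sum g R + sum g (r \<union> G)"
      unfolding R_def using s(1) by (intro sum.subset_diff) auto
    also have "sum g (r \<union> G) = sum g r + sum g G"
      using fin Gr(2) by (intro sum.union_disjoint) auto
    finally show "sum g s = sum g r + sum g G + sum g R" by simp
  qed
  have incr: "sum ?\<Delta> p = sum ?\<Delta> r + sum ?\<Delta> R"
    using split[of ?\<Delta>] sum_increments_division[of q a b f] sum_increments_division[of s a b f] q(2) s(2) ab
    by simp
  have size: "sum (measure lborel) p = sum (measure lborel) r + sum (measure lborel) R"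
    using split[of "measure lborel"] additive_content_division[OF q(2)] additive_content_division[OF s(2)]
    by simp
  define A B where "A = sum (measure lborel) p" and "B = sum (measure lborel) r"
  have AB: "A - B < 2 * \<epsilon>" "0 \<le> A - B"
    using r_size W(3) V(5) size unfolding A_def B_def by (auto simp: sum_nonneg)
  have "R division_of (\<Union>R)"
    using s(2) unfolding R_def by (intro division_of_subset[OF division_of_union_self[OF s(2)]]) auto
  moreover have "\<Union>R \<subseteq> {a..b}"
    using division_ofD(6)[OF s(2)] unfolding R_def by auto
  moreover have "sum (measure lborel) R < \<delta>"
    using AB \<epsilon> size unfolding A_def B_def by linarith
  ultimately have "(\<Sum>K\<in>R. \<bar>?\<Delta> K\<bar>) < c * m / 4" by (rule \<delta>(2))
  then have R: "- (c * m / 4) < sum ?\<Delta> R" using sum_abs[of ?\<Delta> R] by linarith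
  have "sum ?\<Delta> p \<le> (\<Sum>K\<in>p. (\<mu> - c) * measure lborel K)"
  proof (rule sum_mono)
    fix K assume "K \<in> p"
    then obtain u v where "u < v" "K = {u..v}" "f v - f u \<le> (\<mu> - c) * (v - u)" using p_slope by blast
    then show "?\<Delta> K \<le> (\<mu> - c) * measure lborel K" by simp
  qed
  then have P: "sum ?\<Delta> p \<le> (\<mu> - c) * A" unfolding A_def by (simp add: sum_distrib_left)
  have "(\<Sum>K\<in>r. (\<mu> + c) * measure lborel K) \<le> sum ?\<Delta> r"
  proof (rule sum_mono)
    fix K assume "K \<in> r"
    then obtain u v where "u < v" "K = {u..v}" "f v - f u \<ge> (\<mu> + c) * (v - u)" using r_slope by blast
    then show "(\<mu> + c) * measure lborel K \<le> ?\<Delta> K" by simp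
  qed
  then have Q: "(\<mu> + c) * B \<le> sum ?\<Delta> r" unfolding B_def by (simp add: sum_distrib_left)
  have "B \<ge> 0" unfolding B_def by (simp add: sum_nonneg)
  have "- \<mu> * (A - B) \<ge> - (\<bar>\<mu>\<bar> * (2 * \<epsilon>))"
  proof -
    have "\<mu> * (A - B) \<le> \<bar>\<mu>\<bar> * (A - B)" using AB by (intro mult_right_mono) auto
    also have "\<dots> \<le> \<bar>\<mu>\<bar> * (2 * \<epsilon>)" using AB by (intro mult_left_mono) auto
    finally show ?thesis by simp
  qed
  moreover have "\<bar>\<mu>\<bar> * (2 * \<epsilon>) \<le> c * m / 4"
  proof -
    have "\<bar>\<mu>\<bar> * (2 * \<epsilon>) \<le> (\<bar>\<mu>\<bar> + 1) * (2 * \<epsilon>)" using \<epsilon> by simp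
    also have "\<dots> \<le> c * m / 4" using \<epsilon>(4) by (simp add: field_simps)
    finally show ?thesis .
  qed
  \<comment> \<open>The increment over \<open>p\<close> is at most \<open>(\<mu> - c) * A\<close>,
    and by way of \<open>r\<close> and \<open>R\<close> it exceeds
    \<open>(\<mu> + c) * B - c * m / 4\<close>. With \<open>A\<close> close to \<open>B\<close> this
    forces \<open>A < m / 2\<close>, against the size of \<open>p\<close>.\<close>
  moreover have "c * A + c * B - \<mu> * (A - B) < c * m / 4"
    using P Q R incr by (simp add: algebra_simps)
  moreover have "c * B \<ge> 0" using \<open>B \<ge> 0\<close> c by simp
  ultimately have "c * A < c * m / 2" by linarith
  moreover have "c * A > c * (m / 2)" using p_size \<epsilon>(3) c unfolding A_def by (intro mult_strict_left_mono) auto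
  ultimately show False by simp
qed

text \<open>In a window shorter than \<delta>, absolute continuity bounds the total increment of
  disjoint intervals by 1. If the set had positive outer measure there, a Vitali selection of steep
  intervals would exceed this. Countably many windows with rational left ends cover
  \<open>E\<close>.\<close>

lemma negligible_unbounded_slopes:
  fixes f :: "real \<Rightarrow> real"
  assumes ac: "abs_continuous_on {a..b} f" and E: "E \<subseteq> {a<..<b}"
    and steep: "\<And>x d n. x \<in> E \<Longrightarrow> d > 0 \<Longrightarrow>
      \<exists>u v. u < v \<and> x \<in> {u..v} \<and> v - u < d \<and> \<bar>f v - f u\<bar> \<ge> real n * (v - u)"
  shows "negligible E"
proof -
  obtain \<delta> where \<delta>: "\<delta> > 0" "\<And>D. \<lbrakk>D division_of (\<Union>D); \<Union>D \<subseteq> {a..b}; sum (measure lborel) D < \<delta>\<rbrakk>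
        \<Longrightarrow> (\<Sum>K\<in>D. \<bar>f (Sup K) - f (Inf K)\<bar>) < 1"
    by (rule abs_continuous_on_divisionD[OF ac zero_less_one]) iprover
  have local: "negligible (E \<inter> {l<..<l + \<delta> / 2})" for l
  proof (rule ccontr)
    assume nn: "\<not> ?thesis"
    let ?E = "E \<inter> {l<..<l + \<delta> / 2}"
    let ?U = "{a<..<b} \<inter> {l<..<l + \<delta> / 2}"
    have U: "open ?U" "?U \<in> lmeasurable" "?E \<subseteq> ?U" using E by (auto intro!: fmeasurable_Int_fmeasurable)
    obtain m where m: "m > 0" and outer: "\<And>T. T \<in> lmeasurable \<Longrightarrow> ?E \<subseteq> T \<Longrightarrow> m \<le> measure lebesgue T"
      by (rule outer_measure_approx[OF nn U(3,1,2)]) iprover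
    \<comment> \<open>The selected intervals have total length above \<open>m / 2\<close>, so slope
      \<open>n\<close> gives an increment above 1.\<close>
    obtain n :: nat where n: "2 / m < n" using reals_Archimedean2 by blast
    have fine: "\<exists>u v :: real. u < v \<and> x \<in> {u..v} \<and> v - u < d \<and> \<bar>f v - f u\<bar> \<ge> real n * (v - u)" if "x \<in> ?E" "d > 0" for x d :: real
      using steep[of x d n] that by simp
    have m2: "m / 2 > 0" using m by simp
    obtain p where p: "p division_of (\<Union>p)" "\<Union>p \<subseteq> ?U"
      and p_slope: "\<forall>K\<in>p. \<exists>u v. u < v \<and> K = {u..v} \<and> \<bar>f v - f u\<bar> \<ge> real n * (v - u)"
      and p_size: "m - m / 2 < sum (measure lborel) p" "measure lebesgue (\<Union>p) = sum (measure lborel) p"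
      by (rule finite_Vitali_selection[OF U fine outer m2])
    have "sum (measure lborel) p \<le> measure lebesgue {l<..<l + \<delta> / 2}"
      unfolding p_size(2)[symmetric] using p(2) lmeasurable_division[OF p(1)]
      by (intro measure_mono_fmeasurable) (auto dest: fmeasurableD)
    also have "\<dots> < \<delta>" using \<delta> by simp
    finally have "(\<Sum>K\<in>p. \<bar>f (Sup K) - f (Inf K)\<bar>) < 1"
      using p(1,2) by (intro \<delta>(2)) auto
    moreover have "(\<Sum>K\<in>p. n * measure lborel K) \<le> (\<Sum>K\<in>p. \<bar>f (Sup K) - f (Inf K)\<bar>)"
    proof (rule sum_mono)
      fix K assume "K \<in> p"
      then obtain u v where "u < v" "K = {u..v}" "\<bar>f v - f u\<bar> \<ge> real n * (v - u)" using p_slope by blast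
      then show "n * measure lborel K \<le> \<bar>f (Sup K) - f (Inf K)\<bar>" by simp
    qed
    ultimately have "n * sum (measure lborel) p < 1" by (simp add: sum_distrib_left)
    moreover have "n * sum (measure lborel) p \<ge> n * (m / 2)" using p_size(1) by (intro mult_left_mono) auto
    moreover have "n * (m / 2) > 1" using n m by (simp add: field_simps)
    ultimately show False by linarith
  qed
  have "E \<subseteq> (\<Union>l\<in>\<rat>. E \<inter> {l<..<l + \<delta> / 2})"
  proof
    fix x assume "x \<in> E"
    obtain l where "l \<in> \<rat>" "x - \<delta> / 2 < l" "l < x" using Rats_dense_in_real[of "x - \<delta> / 2" x] \<delta> by auto
    then show "x \<in> (\<Union>l\<in>\<rat>. E \<inter> {l<..<l + \<delta> / 2})" using \<open>x \<in> E\<close> by auto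
  qed
  moreover have "negligible (\<Union>l\<in>\<rat>. E \<inter> {l<..<l + \<delta> / 2})"
    using local countable_rat by (intro negligible_countable_Union) auto
  ultimately show ?thesis using negligible_subset by blast
qed

text \<open>Outside \<open>Z\<close> the difference quotients stay bounded near \<open>x\<close>.
  Outside all \<open>N y z\<close> no rational gap separates their lower from their upper limit, so
  they converge. Rational pairs keep the exceptional union countable.\<close>

lemma abs_continuous_on_differentiable_ae:
  fixes f :: "real \<Rightarrow> real"
  assumes ac: "abs_continuous_on {a..b} f"
  shows "negligible {x \<in> {a<..<b}. \<not> f differentiable (at x)}"
proof -
  define cov where "cov x Q \<longleftrightarrow> (\<forall>d>0. \<exists>u v. u < v \<and> x \<in> {u..v} \<and> v - u < d \<and> Q u v)"
    for x and Q :: "real \<Rightarrow> real \<Rightarrow> bool"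
  define Z where "Z = {x \<in> {a<..<b}. \<forall>n::nat. cov x (\<lambda>u v. \<bar>f v - f u\<bar> \<ge> real n * (v - u))}"
  define N where "N y z = {x \<in> {a<..<b}. cov x (\<lambda>u v. f v - f u \<le> y * (v - u)) \<and> cov x (\<lambda>u v. f v - f u \<ge> z * (v - u))}" for y z
  have "negligible Z"
    by (rule negligible_unbounded_slopes[OF ac]) (auto simp: Z_def cov_def)
  have negN: "negligible (N y z)" if "y < z" for y z
    by (rule negligible_two_slopes[OF ac, where \<mu> = "(y + z) / 2" and c = "(z - y) / 2"])
      (use that in \<open>auto simp: N_def cov_def diff_divide_distrib[symmetric] add_divide_distrib[symmetric]\<close>)
  \<comment> \<open>If a bound on the quotients is not eventually true, intervals with one end at
    \<open>x\<close> violate it at every scale; a quotient is symmetric in its two points, so the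
    side does not matter.\<close>
  have slope_cov: "cov x Q"
    if nev: "\<not> (\<forall>\<^sub>F t in at x. P ((f t - f x) / (t - x)))"
      and PQ: "\<And>u v. u < v \<Longrightarrow> \<not> P ((f v - f u) / (v - u)) \<Longrightarrow> Q u v" for x P Q
    unfolding cov_def
  proof (intro allI impI)
    fix d :: real assume "d > 0"
    then obtain t where t: "t \<noteq> x" "dist t x < d" "\<not> P ((f t - f x) / (t - x))"
      using nev unfolding eventually_at by auto
    show "\<exists>u v. u < v \<and> x \<in> {u..v} \<and> v - u < d \<and> Q u v"
    proof (cases "x < t")
      case True
      then show ?thesis using t PQ by (intro exI[of _ x] exI[of _ t]) (auto simp: dist_real_def)
    next
      case False
      have "(f t - f x) / (t - x) = (f x - f t) / (x - t)" by (metis minus_diff_eq minus_divide_divide)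
      then show ?thesis using t PQ False by (intro exI[of _ t] exI[of _ x]) (auto simp: dist_real_def)
    qed
  qed
  have "x \<in> Z \<union> (\<Union>y\<in>\<rat>. \<Union>z\<in>\<rat> \<inter> {y<..}. N y z)"
    if x: "x \<in> {a<..<b}" and nd: "\<not> f differentiable (at x)" for x
  proof (rule ccontr)
    assume no: "\<not> ?thesis"
    let ?h = "\<lambda>t. (f t - f x) / (t - x)"
    obtain n :: nat where "\<not> cov x (\<lambda>u v. \<bar>f v - f u\<bar> \<ge> real n * (v - u))" using no x unfolding Z_def by blast
    then have bnd: "\<forall>\<^sub>F t in at x. \<bar>?h t\<bar> \<le> n"
      by (rule contrapos_np, intro slope_cov[where P = "\<lambda>s. \<bar>s\<bar> \<le> n"])
        (auto simp: field_simps)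
    have dich: "(\<forall>\<^sub>F t in at x. ?h t \<ge> y) \<or> (\<forall>\<^sub>F t in at x. ?h t \<le> z)"
      if "y \<in> \<rat>" "z \<in> \<rat>" "y < z" for y z
    proof (rule ccontr)
      assume "\<not> ?thesis"
      then have nev: "\<not> (\<forall>\<^sub>F t in at x. ?h t \<ge> y)" "\<not> (\<forall>\<^sub>F t in at x. ?h t \<le> z)" by auto
      have "cov x (\<lambda>u v. f v - f u \<le> y * (v - u))"
        by (rule slope_cov[where P = "\<lambda>s. s \<ge> y", OF nev(1)]) (auto simp: field_simps)
      moreover have "cov x (\<lambda>u v. f v - f u \<ge> z * (v - u))"
        by (rule slope_cov[where P = "\<lambda>s. s \<le> z", OF nev(2)]) (auto simp: field_simps)
      ultimately have "x \<in> N y z" using x unfolding N_def by blast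
      then show False using no that by blast
    qed
    \<comment> \<open>The supremum of the eventual lower bounds is the lower limit of the quotients
      and will be the derivative.\<close>
    define A where "A = {y. \<forall>\<^sub>F t in at x. ?h t \<ge> y}"
    have A: "A \<noteq> {}" "bdd_above A"
    proof -
      have "\<forall>\<^sub>F t in at x. ?h t \<ge> - real n"
        using bnd by (rule eventually_mono) (simp only: abs_le_iff, linarith)
      then have "- real n \<in> A" unfolding A_def by simp
      then show "A \<noteq> {}" by blast
      have "y \<le> n" if "y \<in> A" for y
      proof -
        have "\<forall>\<^sub>F t in at x. y \<le> ?h t" using that unfolding A_def by simp
        with bnd have "\<forall>\<^sub>F t in at x. y \<le> real n"
          by (rule eventually_elim2) (simp only: abs_le_iff, linarith)
        then show ?thesis by simp
      qed
      then show "bdd_above A" by (rule bdd_aboveI)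
    qed
    have "(?h \<longlongrightarrow> Sup A) (at x)"
    proof (rule order_tendstoI)
      fix y assume "y < Sup A"
      then obtain y' where "y' \<in> A" "y < y'" using less_cSup_iff[OF A] by blast
      then show "\<forall>\<^sub>F t in at x. y < ?h t" unfolding A_def by (auto elim!: eventually_mono)
    next
      fix z assume "Sup A < z"
      \<comment> \<open>Two rationals are placed above \<open>Sup A\<close>: the lower one is not an
        eventual lower bound, so the dichotomy makes the upper one an eventual upper bound.\<close>
      then obtain z' where z': "z' \<in> \<rat>" "Sup A < z'" "z' < z" using Rats_dense_in_real by blast
      obtain y' where y': "y' \<in> \<rat>" "Sup A < y'" "y' < z'" using Rats_dense_in_real z' by blast
      have "y' \<notin> A" using y' cSup_upper[OF _ A(2), of y'] by linarith
      then have "\<forall>\<^sub>F t in at x. ?h t \<le> z'" using dich[of y' z'] y' z' unfolding A_def by blast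
      then show "\<forall>\<^sub>F t in at x. ?h t < z" using z' by (auto elim!: eventually_mono)
    qed
    then have "(f has_real_derivative Sup A) (at x)" unfolding has_field_derivative_iff .
    then show False using nd real_differentiable_def by blast
  qed
  then have "{x \<in> {a<..<b}. \<not> f differentiable (at x)} \<subseteq> Z \<union> (\<Union>y\<in>\<rat>. \<Union>z\<in>\<rat> \<inter> {y<..}. N y z)" by blast
  moreover have "negligible (Z \<union> (\<Union>y\<in>\<rat>. \<Union>z\<in>\<rat> \<inter> {y<..}. N y z))"
    using \<open>negligible Z\<close> negN countable_rat
    by (intro negligible_Un negligible_countable_Union countable_image) auto
  ultimately show ?thesis using negligible_subset by blast
qed

section \<open>Integration by parts for the gauge integral\<close>

lemma abs_continuous_on_imp_continuous_on:
  fixes f :: "real \<Rightarrow> real"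
  assumes "abs_continuous_on {a..b} f"
  shows "continuous_on {a..b} f"
proof (rule continuous_onI)
  fix x e :: real assume x: "x \<in> {a..b}" and e: "e > 0"
  obtain \<delta> where "\<delta> > 0" and \<delta>: "\<And>(I :: unit set) p q. \<lbrakk>finite I; \<And>i. i \<in> I \<Longrightarrow> p i \<le> q i \<and> {p i..q i} \<subseteq> {a..b};
        \<And>i j. i \<in> I \<Longrightarrow> j \<in> I \<Longrightarrow> i \<noteq> j \<Longrightarrow> {p i<..<q i} \<inter> {p j<..<q j} = {};
        (\<Sum>i\<in>I. q i - p i) < \<delta>\<rbrakk> \<Longrightarrow> (\<Sum>i\<in>I. \<bar>f (q i) - f (p i)\<bar>) < e"
    by (rule abs_continuous_onD[OF assms e, where 'i = unit]) iprover
  have "\<bar>f v - f u\<bar> < e" if "u \<in> {a..b}" "v \<in> {a..b}" "u \<le> v" "v - u < \<delta>" for u v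
    using \<delta>[of UNIV "\<lambda>_. u" "\<lambda>_. v"] that by auto
  then have "dist (f y) (f x) \<le> e" if "y \<in> {a..b}" "dist y x < \<delta>" for y
    using x that by (cases "x \<le> y") (force simp: dist_real_def abs_minus_commute)+
  then show "\<exists>d>0. \<forall>y\<in>{a..b}. dist y x < d \<longrightarrow> dist (f y) (f x) \<le> e"
    using \<open>\<delta> > 0\<close> by blast
qed

lemma negligible_open_cover:
  fixes N :: "real set"
  assumes "negligible N" "e > 0"
  obtains V where "open V" "N \<subseteq> V" "V \<in> lmeasurable" "measure lebesgue V < e"
proof -
  have N: "N \<in> null_sets lebesgue" using assms(1) negligible_iff_null_sets by blast
  then obtain V where V: "open V" "N \<subseteq> V" "V - N \<in> lmeasurable" "emeasure lebesgue (V - N) < ennreal e"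
    using sets_lebesgue_outer_open[of N e] assms(2) by auto
  have eq: "V = (V - N) \<union> N" using V(2) by blast
  have "V \<in> lmeasurable"
    using V(3) negligible_imp_measurable[OF assms(1)] eq fmeasurable.Un by metis
  moreover have "measure lebesgue V = measure lebesgue (V - N)"
    using measure_Un_null_set[OF fmeasurableD[OF V(3)] N] eq by simp
  moreover have "measure lebesgue (V - N) < e"
    using V(3,4) assms(2) by (simp add: emeasure_eq_measure2 ennreal_less_iff)
  ultimately show thesis using that V by simp
qed

lemma sum_disjoint_interval_lengths_le:
  fixes u v :: "'i \<Rightarrow> real"
  assumes I: "finite I" "\<And>i. i \<in> I \<Longrightarrow> u i \<le> v i" "\<And>i. i \<in> I \<Longrightarrow> {u i<..<v i} \<subseteq> V"
    and disj: "\<And>i j. i \<in> I \<Longrightarrow> j \<in> I \<Longrightarrow> i \<noteq> j \<Longrightarrow> {u i<..<v i} \<inter> {u j<..<v j} = {}"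
    and V: "V \<in> lmeasurable"
  shows "(\<Sum>i\<in>I. v i - u i) \<le> measure lebesgue V"
proof -
  have "(\<Sum>i\<in>I. v i - u i) = (\<Sum>i\<in>I. measure lebesgue {u i<..<v i})"
    using I(2) by (intro sum.cong) auto
  also have "\<dots> = measure lebesgue (\<Union>i\<in>I. {u i<..<v i})"
    using I(1) disj by (intro measure_UNION'[symmetric]) (auto simp: pairwise_def disjnt_def)
  also have "\<dots> \<le> measure lebesgue V"
    using I V by (intro measure_mono_fmeasurable) auto
  finally show ?thesis .
qed

lemma has_real_derivative_within_bound:
  fixes f :: "real \<Rightarrow> real"
  assumes "(f has_real_derivative D) (at x within S)" "\<epsilon> > 0"
  obtains d where "d > 0" "\<And>y. y \<in> S \<Longrightarrow> \<bar>y - x\<bar> < d \<Longrightarrow> \<bar>f y - f x - D * (y - x)\<bar> \<le> \<epsilon> * \<bar>y - x\<bar>"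
  using assms unfolding has_field_derivative_def has_derivative_within_alt by (auto simp: mult.commute)

text \<open>At a tag outside \<open>N\<close> the product rule linearises \<open>f * g\<close>. At a
  tag in \<open>N\<close> only \<open>g\<close> is linearised, with \<open>f\<close> frozen at the
  tag; what remains is increments of \<open>f\<close> times values of \<open>g\<close>, and these
  increments are small in total because the cells lie in an open set of measure below
  \<delta>.\<close>

lemma has_integral_abs_continuous_by_parts:
  fixes f g :: "real \<Rightarrow> real"
  assumes ab: "a \<le> b" and ac: "abs_continuous_on {a..b} f" and N: "negligible N"
    and f': "\<And>x. x \<in> {a..b} - N \<Longrightarrow> (f has_real_derivative f' x) (at x within {a..b})"
    and g': "\<And>x. x \<in> {a..b} \<Longrightarrow> (g has_real_derivative g' x) (at x within {a..b})"
  shows "((\<lambda>x. f x * g' x + (if x \<in> N then 0 else f' x * g x)) has_integral f b * g b - f a * g a) {a..b}"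
    (is "(?F has_integral _) _")
  unfolding has_integral_real
proof (intro allI impI)
  fix e :: real assume e: "e > 0"
  let ?h = "\<lambda>x. f x * g x"
  have "continuous_on {a..b} g"
    using g' by (intro DERIV_continuous_on)
  then have "bounded (g ` {a..b})" by (intro compact_imp_bounded compact_continuous_image) auto
  then obtain M where M: "M > 0" "\<And>x. x \<in> {a..b} \<Longrightarrow> \<bar>g x\<bar> \<le> M"
    unfolding bounded_pos by auto
  \<comment> \<open>Error budget: linearisation costs at most \<open>e / 4\<close> in total, and the
    two half-cell sums over tags in \<open>N\<close> cost less than \<open>e / 4\<close> each after
    multiplication by \<open>M\<close>. The 1 in the denominator covers
    \<open>a = b\<close>.\<close>
  define \<epsilon> where "\<epsilon> = e / (4 * (b - a + 1))"
  have \<epsilon>: "\<epsilon> > 0" "\<epsilon> * (b - a) \<le> e / 4" unfolding \<epsilon>_def using e ab by (auto simp: field_simps)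
  have eM: "e / (4 * M) > 0" using e M by simp
  obtain \<delta> where "\<delta> > 0" and \<delta>: "\<And>(I :: (real \<times> real set) set) p q. \<lbrakk>finite I; \<And>i. i \<in> I \<Longrightarrow> p i \<le> q i \<and> {p i..q i} \<subseteq> {a..b};
        \<And>i j. i \<in> I \<Longrightarrow> j \<in> I \<Longrightarrow> i \<noteq> j \<Longrightarrow> {p i<..<q i} \<inter> {p j<..<q j} = {};
        (\<Sum>i\<in>I. q i - p i) < \<delta>\<rbrakk> \<Longrightarrow> (\<Sum>i\<in>I. \<bar>f (q i) - f (p i)\<bar>) < e / (4 * M)"
    by (rule abs_continuous_onD[OF ac eM, where 'i = "real \<times> real set"]) iprover
  obtain V where V: "open V" "N \<subseteq> V" "V \<in> lmeasurable" "measure lebesgue V < \<delta>"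
    using negligible_open_cover[OF N \<open>\<delta> > 0\<close>] by metis
  define P where "P x d \<longleftrightarrow> (x \<in> {a..b} \<longrightarrow>
      (x \<notin> N \<longrightarrow> (\<forall>y\<in>{a..b}. \<bar>y - x\<bar> < d \<longrightarrow> \<bar>?h y - ?h x - ?F x * (y - x)\<bar> \<le> \<epsilon> * \<bar>y - x\<bar>)) \<and>
      (x \<in> N \<longrightarrow> ball x d \<subseteq> V \<and>
        (\<forall>y\<in>{a..b}. \<bar>y - x\<bar> < d \<longrightarrow> \<bar>f x * g y - f x * g x - ?F x * (y - x)\<bar> \<le> \<epsilon> * \<bar>y - x\<bar>)))" for x d
  have "\<exists>d>0. P x d" for x
  proof (cases "x \<in> {a..b}")
    case True
    show ?thesis
    proof (cases "x \<in> N")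
      case xN: False
      have "(?h has_real_derivative ?F x) (at x within {a..b})"
        using DERIV_mult[OF f'[of x] g'[of x]] True xN by (simp add: algebra_simps)
      then obtain d1 where "d1 > 0"
        "\<And>y. y \<in> {a..b} \<Longrightarrow> \<bar>y - x\<bar> < d1 \<Longrightarrow> \<bar>?h y - ?h x - ?F x * (y - x)\<bar> \<le> \<epsilon> * \<bar>y - x\<bar>"
        by (rule has_real_derivative_within_bound[OF _ \<epsilon>(1)]) iprover
      then show ?thesis
        unfolding P_def using xN by (intro exI[of _ d1]) blast
    next
      case xN: True
      have "((\<lambda>y. f x * g y) has_real_derivative ?F x) (at x within {a..b})"
        using DERIV_cmult[OF g'[of x], of "f x"] True xN by simp
      then obtain d1 where d1: "d1 > 0"
        "\<And>y. y \<in> {a..b} \<Longrightarrow> \<bar>y - x\<bar> < d1 \<Longrightarrow> \<bar>f x * g y - f x * g x - ?F x * (y - x)\<bar> \<le> \<epsilon> * \<bar>y - x\<bar>"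
        by (rule has_real_derivative_within_bound[OF _ \<epsilon>(1)]) iprover
      obtain d2 where d2: "d2 > 0" "ball x d2 \<subseteq> V" using openE[OF V(1)] V(2) xN by blast
      show ?thesis
        unfolding P_def using d1 d2 xN by (intro exI[of _ "min d1 d2"]) auto
    qed
  qed (auto simp: P_def intro: exI[of _ 1])
  then obtain d where d0: "\<And>x. d x > 0" and P: "\<And>x. P x (d x)" by metis
  have d_out: "\<bar>?h y - ?h x - ?F x * (y - x)\<bar> \<le> \<epsilon> * \<bar>y - x\<bar>"
    if "x \<in> {a..b}" "x \<notin> N" "y \<in> {a..b}" "\<bar>y - x\<bar> < d x" for x y
    using P[of x] that unfolding P_def by blast
  have d_V: "ball x (d x) \<subseteq> V" if "x \<in> {a..b}" "x \<in> N" for x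
    using P[of x] that unfolding P_def by blast
  have d_in: "\<bar>f x * g y - f x * g x - ?F x * (y - x)\<bar> \<le> \<epsilon> * \<bar>y - x\<bar>"
    if "x \<in> {a..b}" "x \<in> N" "y \<in> {a..b}" "\<bar>y - x\<bar> < d x" for x y
    using P[of x] that unfolding P_def by blast
  show "\<exists>\<gamma>. gauge \<gamma> \<and> (\<forall>\<D>. \<D> tagged_division_of {a..b} \<and> \<gamma> fine \<D> \<longrightarrow>
      norm ((\<Sum>(x, k)\<in>\<D>. measure lborel k *\<^sub>R ?F x) - (f b * g b - f a * g a)) < e)"
  proof (intro exI conjI allI impI)
    show "gauge (\<lambda>x. ball x (d x))" using d0 by (rule gauge_ball_dependent[rule_format])
    fix \<D> assume "\<D> tagged_division_of {a..b} \<and> (\<lambda>x. ball x (d x)) fine \<D>"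
    then have D: "\<D> tagged_division_of {a..b}" and fine: "(\<lambda>x. ball x (d x)) fine \<D>" by auto
    have finD: "finite \<D>" using D by blast
    have iv: "Inf k \<le> x \<and> x \<le> Sup k \<and> Inf k \<in> {a..b} \<and> Sup k \<in> {a..b} \<and> x \<in> {a..b}
        \<and> k = {Inf k..Sup k} \<and> \<bar>Inf k - x\<bar> < d x \<and> \<bar>Sup k - x\<bar> < d x \<and> {Inf k..Sup k} \<subseteq> ball x (d x)"
      if xk: "(x, k) \<in> \<D>" for x k
    proof -
      obtain u v where k: "k = {u..v}" using tagged_division_ofD(4)[OF D xk] by auto
      have x: "x \<in> k" "k \<subseteq> {a..b}" using tagged_division_ofD(2,3)[OF D xk] by auto
      have kb: "k \<subseteq> ball x (d x)" using fine xk unfolding fine_def by blast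
      have uv: "u \<le> x" "x \<le> v" using k x(1) by auto
      then have "u \<in> k" "v \<in> k" using k by auto
      then have "u \<in> {a..b}" "v \<in> {a..b}" "x \<in> {a..b}" "\<bar>u - x\<bar> < d x" "\<bar>v - x\<bar> < d x"
        using x kb by (auto simp: dist_real_def abs_minus_commute)
      then show ?thesis using k uv kb by simp
    qed
    define E where "E = {(x, k) \<in> \<D>. x \<in> N}"
    have finE: "finite E" unfolding E_def using finD by (rule finite_subset[rotated]) auto
    have E: "fst i \<in> N" "i \<in> \<D>" "Inf (snd i) \<le> fst i" "fst i \<le> Sup (snd i)" "Inf (snd i) \<in> {a..b}"
      "Sup (snd i) \<in> {a..b}" "{Inf (snd i)..Sup (snd i)} \<subseteq> V" if "i \<in> E" for i
      using that iv[of "fst i" "snd i"] d_V[of "fst i"] unfolding E_def by (auto split: prod.splits)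
    have Edisj: "{Inf (snd i)<..<Sup (snd i)} \<inter> {Inf (snd j)<..<Sup (snd j)} = {}"
      if "i \<in> E" "j \<in> E" "i \<noteq> j" for i j
    proof -
      have "interior (snd i) \<inter> interior (snd j) = {}"
        using tagged_division_ofD(5)[OF D, of "fst i" "snd i" "fst j" "snd j"] E(2) that
        by (simp add: prod_eq_iff)
      moreover have "interior (snd i) = {Inf (snd i)<..<Sup (snd i)}" if "i \<in> E" for i
        using iv[of "fst i" "snd i"] E(2)[OF that] by (metis interior_atLeastAtMost_real prod.collapse)
      ultimately show ?thesis using that by simp
    qed
    \<comment> \<open>Increments of \<open>f\<close> are measured from the tag, so each cell tagged
      in \<open>N\<close> is cut there and absolute continuity is applied once to each family of
      halves.\<close>
    have right: "(\<Sum>i\<in>E. \<bar>f (Sup (snd i)) - f (fst i)\<bar>) < e / (4 * M)"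
    proof (rule \<delta>[OF finE])
      show disj: "{fst i<..<Sup (snd i)} \<inter> {fst j<..<Sup (snd j)} = {}" if "i \<in> E" "j \<in> E" "i \<noteq> j" for i j
        using Edisj[OF that] E(3)[OF that(1)] E(3)[OF that(2)] by (fastforce simp: disjoint_iff)
      have "(\<Sum>i\<in>E. Sup (snd i) - fst i) \<le> measure lebesgue V"
      proof (rule sum_disjoint_interval_lengths_le[OF finE _ _ disj V(3)])
        show "fst i \<le> Sup (snd i)" if "i \<in> E" for i using E(3,4)[OF that] by simp
        show "{fst i<..<Sup (snd i)} \<subseteq> V" if "i \<in> E" for i
          using E(3,4)[OF that] by (intro order_trans[OF _ E(7)[OF that]]) auto
      qed
      then show "(\<Sum>i\<in>E. Sup (snd i) - fst i) < \<delta>" using V(4) by simp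
      show "fst i \<le> Sup (snd i) \<and> {fst i..Sup (snd i)} \<subseteq> {a..b}" if "i \<in> E" for i
        using E(3-6)[OF that] by auto
    qed
    have left: "(\<Sum>i\<in>E. \<bar>f (fst i) - f (Inf (snd i))\<bar>) < e / (4 * M)"
    proof (rule \<delta>[OF finE])
      show disj: "{Inf (snd i)<..<fst i} \<inter> {Inf (snd j)<..<fst j} = {}" if "i \<in> E" "j \<in> E" "i \<noteq> j" for i j
        using Edisj[OF that] E(4)[OF that(1)] E(4)[OF that(2)] by (fastforce simp: disjoint_iff)
      have "(\<Sum>i\<in>E. fst i - Inf (snd i)) \<le> measure lebesgue V"
      proof (rule sum_disjoint_interval_lengths_le[OF finE _ _ disj V(3)])
        show "Inf (snd i) \<le> fst i" if "i \<in> E" for i using E(3,4)[OF that] by simp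
        show "{Inf (snd i)<..<fst i} \<subseteq> V" if "i \<in> E" for i
          using E(3,4)[OF that] by (intro order_trans[OF _ E(7)[OF that]]) auto
      qed
      then show "(\<Sum>i\<in>E. fst i - Inf (snd i)) < \<delta>" using V(4) by simp
      show "Inf (snd i) \<le> fst i \<and> {Inf (snd i)..fst i} \<subseteq> {a..b}" if "i \<in> E" for i
        using E(3-6)[OF that] by auto
    qed
    define t where "t i = measure lborel (snd i) * ?F (fst i) - (?h (Sup (snd i)) - ?h (Inf (snd i)))" for i
    define r where "r i = (if i \<in> E then M * (\<bar>f (Sup (snd i)) - f (fst i)\<bar> + \<bar>f (fst i) - f (Inf (snd i))\<bar>) else 0)" for i
    have t_le: "\<bar>t i\<bar> \<le> \<epsilon> * measure lborel (snd i) + r i" if i: "i \<in> \<D>" for i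
    proof -
      obtain x k where [simp]: "i = (x, k)" by (cases i)
      define u v where "u = Inf k" and "v = Sup k"
      have uv: "u \<le> x" "x \<le> v" "u \<in> {a..b}" "v \<in> {a..b}" "x \<in> {a..b}" "k = {u..v}"
        "\<bar>u - x\<bar> < d x" "\<bar>v - x\<bar> < d x"
        using iv[of x k] i unfolding u_def v_def by auto
      have ct: "measure lborel k = v - u" using uv by simp
      have t_eq: "t i = (v - u) * ?F x - (?h v - ?h u)"
        unfolding t_def by (simp only: \<open>i = (x, k)\<close> fst_conv snd_conv ct u_def[symmetric] v_def[symmetric])
      have lin: "\<epsilon> * \<bar>v - x\<bar> + \<epsilon> * \<bar>u - x\<bar> = \<epsilon> * (v - u)" using uv by (simp add: algebra_simps)
      show ?thesis
      proof (cases "x \<in> N")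
        case False
        have "t i = (?h u - ?h x - ?F x * (u - x)) - (?h v - ?h x - ?F x * (v - x))"
          unfolding t_eq by (simp add: algebra_simps)
        moreover have "\<bar>?h u - ?h x - ?F x * (u - x)\<bar> \<le> \<epsilon> * \<bar>u - x\<bar>" "\<bar>?h v - ?h x - ?F x * (v - x)\<bar> \<le> \<epsilon> * \<bar>v - x\<bar>"
          using d_out[of x] uv False by blast+
        moreover have "r i = 0" using False unfolding r_def E_def by simp
        ultimately show ?thesis using lin ct by (simp only: \<open>i = (x, k)\<close> snd_conv)
      next
        case True
        then have iE: "i \<in> E" using i unfolding E_def by simp
        have tri: "\<bar>p - q + (y - z)\<bar> \<le> p' + q' + (y' + z')"
          if "\<bar>p\<bar> \<le> p'" "\<bar>q\<bar> \<le> q'" "\<bar>y\<bar> \<le> y'" "\<bar>z\<bar> \<le> z'" for p q y z p' q' y' z' :: real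
          using that by linarith
        \<comment> \<open>Two linearisation errors of \<open>g\<close> with \<open>f x\<close>
          frozen, plus the part due to the variation of \<open>f\<close>.\<close>
        have t_split: "t i = (f x * g u - f x * g x - ?F x * (u - x)) - (f x * g v - f x * g x - ?F x * (v - x))
            + (g u * (f u - f x) - g v * (f v - f x))"
          unfolding t_eq by (simp add: algebra_simps)
        have "\<bar>t i\<bar> \<le> \<epsilon> * \<bar>u - x\<bar> + \<epsilon> * \<bar>v - x\<bar> + (M * \<bar>f x - f u\<bar> + M * \<bar>f v - f x\<bar>)"
          unfolding t_split
        proof (rule tri)
          show "\<bar>f x * g u - f x * g x - ?F x * (u - x)\<bar> \<le> \<epsilon> * \<bar>u - x\<bar>"
              "\<bar>f x * g v - f x * g x - ?F x * (v - x)\<bar> \<le> \<epsilon> * \<bar>v - x\<bar>"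
            using d_in[of x] uv True by blast+
          show "\<bar>g u * (f u - f x)\<bar> \<le> M * \<bar>f x - f u\<bar>" "\<bar>g v * (f v - f x)\<bar> \<le> M * \<bar>f v - f x\<bar>"
            using M(2)[OF uv(3)] M(2)[OF uv(4)] by (auto simp: abs_mult abs_minus_commute intro!: mult_right_mono)
        qed
        moreover have "r i = M * \<bar>f v - f x\<bar> + M * \<bar>f x - f u\<bar>"
          using iE unfolding r_def u_def v_def by (simp add: distrib_left)
        ultimately show ?thesis using lin ct by simp
      qed
    qed
    have "(\<Sum>i\<in>\<D>. r i) = (\<Sum>i\<in>E. M * (\<bar>f (Sup (snd i)) - f (fst i)\<bar> + \<bar>f (fst i) - f (Inf (snd i))\<bar>))"
      unfolding r_def using finD E(2) by (intro sum.mono_neutral_cong_right) auto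
    also have "\<dots> = M * ((\<Sum>i\<in>E. \<bar>f (Sup (snd i)) - f (fst i)\<bar>) + (\<Sum>i\<in>E. \<bar>f (fst i) - f (Inf (snd i))\<bar>))"
      by (simp add: sum.distrib sum_distrib_left distrib_left)
    also have "\<dots> < M * (e / (4 * M) + e / (4 * M))"
      using left right M(1) by (intro mult_strict_left_mono add_strict_mono)
    also have "\<dots> = e / 2" using M(1) by (simp add: field_simps)
    finally have r: "(\<Sum>i\<in>\<D>. r i) < e / 2" .
    have "(\<Sum>i\<in>\<D>. ?h (Sup (snd i)) - ?h (Inf (snd i))) = ?h b - ?h a"
      using additive_tagged_division_1[OF ab D, of ?h] by (simp add: case_prod_beta)
    then have "(\<Sum>(x, k)\<in>\<D>. measure lborel k *\<^sub>R ?F x) - (f b * g b - f a * g a) = (\<Sum>i\<in>\<D>. t i)"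
      unfolding t_def by (simp add: sum_subtractf case_prod_beta)
    also have "norm \<dots> \<le> (\<Sum>i\<in>\<D>. \<epsilon> * measure lborel (snd i) + r i)"
      unfolding real_norm_def using t_le by (intro order_trans[OF sum_abs] sum_mono)
    also have "\<dots> = \<epsilon> * (b - a) + (\<Sum>i\<in>\<D>. r i)"
      using additive_content_tagged_division[of \<D> a b] D ab
      by (simp add: sum.distrib sum_distrib_left[symmetric] case_prod_beta)
    also have "\<dots> < e" using r \<epsilon>(2) e by linarith
    finally show "norm ((\<Sum>(x, k)\<in>\<D>. measure lborel k *\<^sub>R ?F x) - (f b * g b - f a * g a)) < e" .
  qed
qed

section \<open>Measurability and the scalar estimate\<close>

text \<open>Off a null set the norm of the derivative is a limit of norms of difference quotients,
  which are continuous real functions. Working with norms avoids measurability of maps into a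
  possibly nonseparable operator space.\<close>

lemma norm_derivative_measurable:
  fixes f :: "real \<Rightarrow> 'a::real_normed_vector"
  assumes ab: "a \<le> b" and cont: "continuous_on {a..b} f" and N: "negligible N"
    and f': "\<And>x. x \<in> {a<..<b} - N \<Longrightarrow> (f has_vector_derivative f' x) (at x)"
  shows "(\<lambda>x. indicator ({a<..<b} - N) x * norm (f' x)) \<in> borel_measurable lebesgue"
proof (rule borel_measurable_LIMSEQ_real)
  \<comment> \<open>Clamping extends \<open>f\<close> continuously to the whole line, so the shifted
    quotients make sense everywhere; at an interior point the clamp is eventually inactive.\<close>
  define c where "c x = max a (min b x)" for x
  have c: "c x \<in> {a..b}" for x unfolding c_def using ab by auto
  have "continuous_on UNIV c" unfolding c_def by (intro continuous_intros)
  then have fc: "continuous_on UNIV (\<lambda>x. f (c x))"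
    using c by (intro continuous_on_compose2[OF cont]) auto
  let ?h = "\<lambda>n. inverse (real (Suc n))"
  let ?g = "\<lambda>n x. norm (f (c (x + ?h n)) - f (c x)) / ?h n"
  have "continuous_on UNIV (\<lambda>x. f (c (x + ?h n)))" for n
    by (rule continuous_on_compose2[OF fc, where f = "\<lambda>x. x + ?h n"]) (auto intro: continuous_on_add continuous_on_id continuous_on_const)
  then have "continuous_on UNIV (?g n)" for n
    by (intro continuous_on_divide continuous_on_norm continuous_on_diff fc continuous_on_const) auto
  then have "?g n \<in> borel_measurable lebesgue" for n
    using borel_measurable_continuous_onI[of "?g n"] by (intro measurable_completion) simp
  moreover have "indicator ({a<..<b} - N) \<in> borel_measurable lebesgue"
    using negligible_imp_sets[OF N] by (intro borel_measurable_indicator sets.Diff) auto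
  ultimately show "(\<lambda>x. indicator ({a<..<b} - N) x * ?g n x) \<in> borel_measurable lebesgue" for n
    by (intro borel_measurable_times)
  show "(\<lambda>n. indicator ({a<..<b} - N) x * ?g n x) \<longlonglongrightarrow> indicator ({a<..<b} - N) x * norm (f' x)" for x
  proof (cases "x \<in> {a<..<b} - N")
    case True
    have h0: "?h \<longlonglongrightarrow> 0" by (rule LIMSEQ_inverse_real_of_nat)
    have fl: "filterlim ?h (at 0) sequentially"
      using h0 by (intro filterlim_atI) auto
    have "((\<lambda>h. norm (f (x + h) - f x - h *\<^sub>R f' x) / norm h) \<longlongrightarrow> 0) (at 0)"
      using f'[OF True] unfolding has_vector_derivative_def has_derivative_at by simp
    from filterlim_compose[OF this fl]
    have l1: "(\<lambda>n. norm (f (x + ?h n) - f x - ?h n *\<^sub>R f' x) / norm (?h n)) \<longlonglongrightarrow> 0" .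
    have "(\<lambda>n. norm (f (x + ?h n) - f x) / ?h n - norm (f' x)) \<longlonglongrightarrow> 0"
    proof (rule Lim_null_comparison[OF always_eventually l1], rule allI)
      fix n
      have h: "?h n > 0" by simp
      have "\<bar>norm (f (x + ?h n) - f x) - norm (?h n *\<^sub>R f' x)\<bar> \<le> norm (f (x + ?h n) - f x - ?h n *\<^sub>R f' x)"
        by (rule norm_triangle_ineq3)
      then have "\<bar>norm (f (x + ?h n) - f x) - norm (?h n *\<^sub>R f' x)\<bar> / ?h n \<le> norm (f (x + ?h n) - f x - ?h n *\<^sub>R f' x) / ?h n"
        using h by (intro divide_right_mono) auto
      moreover have "norm (f (x + ?h n) - f x) / ?h n - norm (f' x) = (norm (f (x + ?h n) - f x) - norm (?h n *\<^sub>R f' x)) / ?h n"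
        using h by (simp add: diff_divide_distrib)
      ultimately show "norm (norm (f (x + ?h n) - f x) / ?h n - norm (f' x)) \<le> norm (f (x + ?h n) - f x - ?h n *\<^sub>R f' x) / norm (?h n)"
        using h by (simp only: real_norm_def abs_divide abs_of_pos)
    qed
    then have l2: "(\<lambda>n. norm (f (x + ?h n) - f x) / ?h n) \<longlonglongrightarrow> norm (f' x)" by (rule LIM_zero_cancel)
    have "\<forall>\<^sub>F n in sequentially. x + ?h n < b"
      using order_tendstoD(2)[OF h0, of "b - x"] True by (auto elim!: eventually_mono)
    then have "\<forall>\<^sub>F n in sequentially. norm (f (x + ?h n) - f x) / ?h n = indicator ({a<..<b} - N) x * ?g n x"
    proof (rule eventually_mono)
      fix n assume less: "x + ?h n < b"
      have "a < x" "x < b" using True by auto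
      moreover have "?h n > 0" by simp
      ultimately have "a < x + ?h n" by linarith
      then have "c (x + ?h n) = x + ?h n" "c x = x"
        using less \<open>a < x\<close> \<open>x < b\<close> unfolding c_def by simp_all
      then show "norm (f (x + ?h n) - f x) / ?h n = indicator ({a<..<b} - N) x * ?g n x" using True by simp
    qed
    then have "(\<lambda>n. indicator ({a<..<b} - N) x * ?g n x) \<longlonglongrightarrow> norm (f' x)" using l2 by (simp only: tendsto_cong)
    then show ?thesis using True by simp
  qed simp
qed

text \<open>The derivative of \<open>F - \<phi> \<tau>\<close> is \<open>- \<phi> \<xi> - \<phi>' \<tau>\<close>: both \<open>F'\<close> and \<open>\<tau>'\<close>, for which no bound is
  available, cancel.\<close>

lemma abs_continuous_integral_estimate:
  fixes X X' :: "real \<Rightarrow> 'a::real_normed_vector" and \<phi> \<tau> F :: "real \<Rightarrow> real"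
  assumes ab: "a \<le> b" and ac: "abs_continuous_on {a..b} \<phi>" and pos: "\<And>s. s \<in> {a..b} \<Longrightarrow> \<phi> s \<ge> 0"
    and X: "\<And>s. s \<in> {a..b} \<Longrightarrow> (X has_vector_derivative X' s) (at s within {a..b})"
    and \<tau>: "\<And>s. s \<in> {a..b} \<Longrightarrow> (\<tau> has_real_derivative \<tau>' s) (at s within {a..b})"
    and F: "\<And>s. s \<in> {a..b} \<Longrightarrow> (F has_real_derivative \<phi> s * (\<tau>' s - \<xi> s)) (at s within {a..b})"
    and \<tau>_le: "\<And>s. s \<in> {a..b} \<Longrightarrow> \<bar>\<tau> s\<bar> \<le> norm (X s)"
    and \<xi>_le: "\<And>s. s \<in> {a..b} \<Longrightarrow> \<bar>\<xi> s\<bar> \<le> norm (X' s)"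
  shows "ennreal (F a - F b) \<le> ennreal (norm (X a) * \<phi> a) + ennreal (norm (X b) * \<phi> b)
     + (\<integral>\<^sup>+ s \<in> {a..b}. ennreal (norm (X' s) * \<phi> s + \<bar>deriv \<phi> s\<bar> * norm (X s)) \<partial>lborel)"
    (is "_ \<le> _ + _ + ?I")
proof (cases "?I = \<infinity>")
  case True
  then show ?thesis by simp
next
  case False
  \<comment> \<open>The endpoints are included because \<open>deriv\<close> is two-sided, whereas
    \<phi> is arbitrary outside \<open>{a..b}\<close>.\<close>
  define N where "N = {a, b} \<union> {x \<in> {a<..<b}. \<not> \<phi> differentiable (at x)}"
  have N: "negligible N"
    unfolding N_def using abs_continuous_on_differentiable_ae[OF ac] by (intro negligible_Un) auto
  have \<phi>': "(\<phi> has_real_derivative deriv \<phi> s) (at s)" if "s \<in> {a..b} - N" for s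
    using that unfolding N_def by (auto simp: DERIV_deriv_iff_real_differentiable)
  define D where "D = {a<..<b} - N"
  have D_eq: "D = {a..b} - N" unfolding D_def N_def by auto
  \<comment> \<open>Cutting off \<open>N\<close> changes the integral by nothing and removes the
    points where \<open>deriv \<phi>\<close> may be meaningless.\<close>
  define G where "G s = indicator D s * (norm (X' s) * \<phi> s + \<bar>deriv \<phi> s\<bar> * norm (X s))" for s
  have G0: "G s \<ge> 0" for s
    unfolding G_def D_eq using pos by (auto simp: indicator_def)
  define c where "c x = max a (min b x)" for x
  have c: "c x \<in> {a..b}" for x unfolding c_def using ab by auto
  have cc: "continuous_on UNIV c" unfolding c_def by (intro continuous_intros)
  have X_cont: "continuous_on {a..b} X"
    using X by (rule continuous_on_vector_derivative)
  note \<phi>_cont = abs_continuous_on_imp_continuous_on[OF ac]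
  have G_meas: "G \<in> borel_measurable lebesgue"
  proof -
    have m1: "(\<lambda>s. \<phi> (c s)) \<in> borel_measurable lebesgue" "(\<lambda>s. norm (X (c s))) \<in> borel_measurable lebesgue"
      using c by (auto intro!: measurable_completion borel_measurable_continuous_onI continuous_on_norm
          continuous_on_compose2[OF \<phi>_cont cc] continuous_on_compose2[OF X_cont cc])
    have m2: "(\<lambda>x. indicator D x * norm (X' x)) \<in> borel_measurable lebesgue"
      unfolding D_def
    proof (rule norm_derivative_measurable[OF ab X_cont N])
      fix x assume "x \<in> {a<..<b} - N"
      then show "(X has_vector_derivative X' x) (at x)"
        using X[of x] at_within_Icc_at[of a x b] by simp
    qed
    have m3: "(\<lambda>x. indicator D x * norm (deriv \<phi> x)) \<in> borel_measurable lebesgue"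
      unfolding D_def
      using \<phi>' by (intro norm_derivative_measurable[OF ab \<phi>_cont N])
        (auto simp: has_real_derivative_iff_has_vector_derivative)
    have "G = (\<lambda>s. (indicator D s * norm (X' s)) * \<phi> (c s) + (indicator D s * norm (deriv \<phi> s)) * norm (X (c s)))"
      unfolding G_def D_eq c_def by (auto simp: fun_eq_iff indicator_def min_def max_def)
    then show ?thesis
      using borel_measurable_add[OF borel_measurable_times[OF m2 m1(1)] borel_measurable_times[OF m3 m1(2)]] by simp
  qed
  have "?I = (\<integral>\<^sup>+ s. ennreal (norm (X' s) * \<phi> s + \<bar>deriv \<phi> s\<bar> * norm (X s)) * indicator {a..b} s \<partial>lebesgue)"
    by (rule nn_integral_completion[symmetric])
  also have "\<dots> = (\<integral>\<^sup>+ s. ennreal (G s) \<partial>lebesgue)"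
  proof (rule nn_integral_cong_AE, rule AE_I')
    show "N \<in> null_sets lebesgue" using N negligible_iff_null_sets by blast
  qed (auto simp: G_def D_eq indicator_def)
  finally have I_eq: "?I = (\<integral>\<^sup>+ s. ennreal (G s) \<partial>lebesgue)" .
  \<comment> \<open>A finite Lebesgue integral of the nonnegative \<open>G\<close> is also its gauge
    integral, so it can be compared with the integral obtained by parts.\<close>
  define r where "r = enn2real ?I"
  have r: "?I = ennreal r" "r \<ge> 0" unfolding r_def using False by (auto simp: less_top[symmetric])
  have "(G has_integral r) UNIV"
    using G0 G_meas I_eq r by (subst has_integral_iff_nn_integral_lebesgue) auto
  have by_parts: "((\<lambda>s. \<phi> s * \<tau>' s + (if s \<in> N then 0 else deriv \<phi> s * \<tau> s)) has_integral \<phi> b * \<tau> b - \<phi> a * \<tau> a) {a..b}"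
    by (rule has_integral_abs_continuous_by_parts[OF ab ac N _ \<tau>])
      (use \<phi>' has_field_derivative_at_within in blast)
  have "((\<lambda>s. \<phi> s * (\<tau>' s - \<xi> s)) has_integral F b - F a) {a..b}"
    using F ab by (intro fundamental_theorem_of_calculus) (auto simp: has_real_derivative_iff_has_vector_derivative)
  \<comment> \<open>Subtracting the fundamental theorem for \<open>F\<close> removes
    \<open>\<phi> * \<tau>'\<close>, leaving terms that \<open>G\<close> dominates pointwise off
    \<open>N\<close>.\<close>
  from has_integral_diff[OF by_parts this]
  have "((\<lambda>s. \<phi> s * \<xi> s + (if s \<in> N then 0 else deriv \<phi> s * \<tau> s)) has_integral
      (\<phi> b * \<tau> b - \<phi> a * \<tau> a) - (F b - F a)) {a..b}"
    by (rule has_integral_eq[rotated]) (simp add: algebra_simps)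
  then have K: "((\<lambda>s. if s \<in> {a..b} then \<phi> s * \<xi> s + (if s \<in> N then 0 else deriv \<phi> s * \<tau> s) else 0) has_integral
      (\<phi> b * \<tau> b - \<phi> a * \<tau> a) - (F b - F a)) UNIV"
    unfolding has_integral_restrict_UNIV .
  have "((\<lambda>s. indicator D s * (\<phi> s * \<xi> s + deriv \<phi> s * \<tau> s)) has_integral
      (\<phi> b * \<tau> b - \<phi> a * \<tau> a) - (F b - F a)) UNIV"
    by (rule has_integral_spike[OF N _ K]) (auto simp: D_eq indicator_def)
  then have "(\<phi> b * \<tau> b - \<phi> a * \<tau> a) - (F b - F a) \<le> r"
  proof (rule has_integral_le[OF _ \<open>(G has_integral r) UNIV\<close>])
    fix s
    show "indicator D s * (\<phi> s * \<xi> s + deriv \<phi> s * \<tau> s) \<le> G s"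
    proof (cases "s \<in> D")
      case True
      then have s: "s \<in> {a..b}" unfolding D_eq by simp
      have "\<phi> s * \<xi> s \<le> norm (X' s) * \<phi> s"
        using mult_left_mono[OF \<xi>_le[OF s] pos[OF s]] mult_left_mono[OF abs_ge_self[of "\<xi> s"] pos[OF s]]
        by (simp add: mult.commute)
      moreover have "deriv \<phi> s * \<tau> s \<le> \<bar>deriv \<phi> s\<bar> * norm (X s)"
        using mult_left_mono[OF \<tau>_le[OF s], of "\<bar>deriv \<phi> s\<bar>"] abs_ge_self[of "deriv \<phi> s * \<tau> s"]
        by (simp add: abs_mult)
      ultimately show ?thesis using True unfolding G_def by simp
    qed (simp add: G_def)
  qed
  moreover have "\<bar>\<phi> s * \<tau> s\<bar> \<le> norm (X s) * \<phi> s" if "s \<in> {a..b}" for s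
    using mult_right_mono[OF \<tau>_le[OF that] pos[OF that]] pos[OF that] by (simp add: abs_mult mult.commute)
  then have "\<bar>\<phi> a * \<tau> a\<bar> \<le> norm (X a) * \<phi> a" "\<bar>\<phi> b * \<tau> b\<bar> \<le> norm (X b) * \<phi> b" using ab by auto
  ultimately have "F a - F b \<le> norm (X a) * \<phi> a + norm (X b) * \<phi> b + r" by linarith
  then have "ennreal (F a - F b) \<le> ennreal (norm (X a) * \<phi> a + norm (X b) * \<phi> b + r)" by (rule ennreal_leI)
  also have "\<dots> = ennreal (norm (X a) * \<phi> a) + ennreal (norm (X b) * \<phi> b) + ?I"
    using pos ab r by (simp add: ennreal_plus)
  finally show ?thesis .
qed


section \<open>The adiabatic estimate\<close>

theorem theorem1:
  fixes J :: "'h::{real_inner, complete_space} \<Rightarrow>\<^sub>L 'h"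
    and P P' X X' :: "real \<Rightarrow> ('h \<Rightarrow>\<^sub>L 'h)"
    and \<rho> :: "real \<Rightarrow> ('h \<Rightarrow>\<^sub>L 'h)"
    and lam :: "real \<Rightarrow> real"
    and L :: "real \<Rightarrow> ('h \<Rightarrow>\<^sub>L 'h) \<Rightarrow> ('h \<Rightarrow>\<^sub>L 'h)"
  assumes J: "complex_structure J"
    \<comment> \<open>P(s): differentiable family of orthogonal projectors\<close>
    and P_proj: "\<forall>s\<in>{0..1}. orth_projector J (P s)"
    and P_deriv: "\<forall>s\<in>{0..1}. (P has_vector_derivative P' s) (at s within {0..1})"
    \<comment> \<open>\<rho>(s): density matrices\<close>
    and \<rho>_dens: "\<forall>s\<in>{0..1}. density_op J (\<rho> s)"
    \<comment> \<open>\<lambda> : [0,1] \<rightarrow> (0,\<infinity>)\<close>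
    and lam_pos: "\<forall>s\<in>{0..1}. lam s > 0"
    \<comment> \<open>L_s: complex-linear operator on trace-class (complex-linear) operators\<close>
    and L_tc: "\<forall>s\<in>{0..1}. \<forall>A. clinear_op J A \<and> trace_class A \<longrightarrow>
                 clinear_op J (L s A) \<and> trace_class (L s A)"
    and L_add: "\<forall>s\<in>{0..1}. \<forall>A B. clinear_op J A \<and> trace_class A \<and> clinear_op J B \<and> trace_class B
                 \<longrightarrow> L s (A + B) = L s A + L s B"
    and L_scale: "\<forall>s\<in>{0..1}. \<forall>c A. clinear_op J A \<and> trace_class A
                 \<longrightarrow> L s (cscale_op J c A) = cscale_op J c (L s A)"
    \<comment> \<open>the differential equation d\<rho>/ds = \<lambda>(s) L_s(\<rho>) (derivative in trace norm)\<close>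
    and ode: "\<forall>s\<in>{0..1}. has_trace_norm_derivative \<rho> (lam s *\<^sub>R L s (\<rho> s)) s {0..1}"
    \<comment> \<open>(a)\<close>
    and a: "ctrace J (P 0 o\<^sub>L \<rho> 0) = 1"
    \<comment> \<open>(b)\<close>
    and b: "\<forall>s\<in>{0..1}. \<forall>A. clinear_op J A \<and> trace_class A \<longrightarrow> ctrace J (P s o\<^sub>L L s A) = 0"
    \<comment> \<open>(c): X differentiable family of bounded operators with P'(s) = L_s^*(X(s))\<close>
    and X_clin: "\<forall>s\<in>{0..1}. clinear_op J (X s)"
    and X_deriv: "\<forall>s\<in>{0..1}. (X has_vector_derivative X' s) (at s within {0..1})"
    and c: "\<forall>s\<in>{0..1}. \<forall>\<sigma>. clinear_op J \<sigma> \<and> trace_class \<sigma> \<longrightarrow>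
              ctrace J (P' s o\<^sub>L \<sigma>) = ctrace J (X s o\<^sub>L L s \<sigma>)"
    \<comment> \<open>(d)\<close>
    and d: "abs_continuous_on {0..1} (\<lambda>s. 1 / lam s)"
  shows "ennreal (1 - Re (ctrace J (P 1 o\<^sub>L \<rho> 1)))
           \<le> ennreal (norm (X 0) / lam 0) + ennreal (norm (X 1) / lam 1)
             + (\<integral>\<^sup>+ s \<in> {0..1}. ennreal (norm (X' s) / lam s
                  + \<bar>deriv (\<lambda>t. 1 / lam t) s\<bar> * norm (X s)) \<partial>lborel)"
proof -
  \<comment> \<open>The factor 1/2 turns real traces into real parts of complex ones and normalises
    the real trace 2 of a density operator to 1.\<close>
  define F where "F s = rtrace (P s o\<^sub>L \<rho> s) / 2" for s
  define \<tau> where "\<tau> s = rtrace (X s o\<^sub>L \<rho> s) / 2" for s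
  define \<xi> where "\<xi> s = rtrace (X' s o\<^sub>L \<rho> s) / 2" for s
  \<comment> \<open>The link between the two derivatives: by (b) and (c) it is the derivative of
    \<open>F\<close>, and multiplied by \<open>lam s\<close> it is the contribution of the evolution
    of \<rho> to that of \<tau>.\<close>
  define y where "y s = rtrace (X s o\<^sub>L L s (\<rho> s)) / 2" for s
  have Re_ctrace: "Re (ctrace J T) = rtrace T / 2" for T unfolding ctrace_def by simp
  have \<rho>: "clinear_op J (\<rho> s)" "trace_class (\<rho> s)" if "s \<in> {0..1}" for s
    using \<rho>_dens that unfolding density_op_def by auto
  have L: "trace_class (L s (\<rho> s))" if "s \<in> {0..1}" for s using L_tc \<rho>[OF that] that by blast
  have bound: "\<bar>rtrace (A o\<^sub>L \<rho> s)\<bar> \<le> 2 * norm A" if "s \<in> {0..1}" for A s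
    using \<rho>_dens that rtrace_compose_density_bound by blast
  have deriv: "((\<lambda>t. rtrace (A t o\<^sub>L \<rho> t) / 2) has_real_derivative
      rtrace (A' o\<^sub>L \<rho> s) / 2 + lam s * (rtrace (A s o\<^sub>L L s (\<rho> s)) / 2)) (at s within {0..1})"
    if s: "s \<in> {0..1}" and A: "(A has_vector_derivative A') (at s within {0..1})" for A A' s
  proof -
    have "(A s o\<^sub>L lam s *\<^sub>R L s (\<rho> s)) = lam s *\<^sub>R (A s o\<^sub>L L s (\<rho> s))"
      by (rule blinfun_eqI) (simp add: blinfun.scaleR_left blinfun.scaleR_right)
    then have "rtrace (A s o\<^sub>L lam s *\<^sub>R L s (\<rho> s)) = lam s * rtrace (A s o\<^sub>L L s (\<rho> s))"
      by (simp add: rtrace_scaleR)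
    then show ?thesis
      using DERIV_cdivide[OF has_real_derivative_rtrace_compose[OF \<rho>(2) trace_class_scaleR[OF L[OF s]] bound
          bspec[OF ode s] s A], of 2]
      by (simp add: add_divide_distrib)
  qed
  have F': "(F has_real_derivative y s) (at s within {0..1})" if s: "s \<in> {0..1}" for s
  proof -
    have "rtrace (P s o\<^sub>L L s (\<rho> s)) / 2 = 0" using b s \<rho>[OF s] Re_ctrace by (metis zero_complex.sel(1))
    moreover have "rtrace (P' s o\<^sub>L \<rho> s) / 2 = y s"
      unfolding y_def using c s \<rho>[OF s] Re_ctrace by metis
    ultimately show ?thesis
      using deriv[OF s bspec[OF P_deriv s]] unfolding F_def by simp
  qed
  have \<tau>': "(\<tau> has_real_derivative \<xi> s + lam s * y s) (at s within {0..1})" if s: "s \<in> {0..1}" for s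
    using deriv[OF s bspec[OF X_deriv s]] unfolding \<tau>_def \<xi>_def y_def .
  have "ennreal (F 0 - F 1) \<le> ennreal (norm (X 0) * (1 / lam 0)) + ennreal (norm (X 1) * (1 / lam 1))
     + (\<integral>\<^sup>+ s \<in> {0..1}. ennreal (norm (X' s) * (1 / lam s) + \<bar>deriv (\<lambda>t. 1 / lam t) s\<bar> * norm (X s)) \<partial>lborel)"
  proof (rule abs_continuous_integral_estimate[OF _ d _ bspec[OF X_deriv] \<tau>', where \<xi> = \<xi>])
    fix s :: real assume s: "s \<in> {0..1}"
    then have l: "lam s > 0" using lam_pos by blast
    then show "0 \<le> 1 / lam s" by simp
    show "(F has_real_derivative 1 / lam s * (\<xi> s + lam s * y s - \<xi> s)) (at s within {0..1})"
      using F'[OF s] l by simp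
    show "\<bar>\<tau> s\<bar> \<le> norm (X s)" "\<bar>\<xi> s\<bar> \<le> norm (X' s)"
      using bound[OF s, of "X s"] bound[OF s, of "X' s"] unfolding \<tau>_def \<xi>_def by auto
  qed auto
  moreover have "F 0 = 1" using a Re_ctrace[of "P 0 o\<^sub>L \<rho> 0"] unfolding F_def by simp
  ultimately show ?thesis unfolding Re_ctrace F_def[symmetric] by simp
qed

end
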